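(* Let $k\ge 1$ be an integer and $\theta = 2\pi/(4k+4)$. Let $P$ be a finite set of points in general position and $S$ a set of constraints on $P$. Let $u,w\in P$ be two vertices such that $u$ can see $w$, let $m$ be the midpoint of the side of the canonical triangle $T_{uw}$ opposite $u$, and let $\alpha$ be the unsigned angle between $uw$ and $um$. Then there exists a path connecting $u$ and $w$ in the constrained $\theta_{(4k+4)}$-graph of $P$ with respect to $S$ of length at most \[\left( \frac{\cos \alpha}{\cos \left(\frac{\theta}{2}\right)} + \frac{\cos \alpha \cdot \tan \left(\frac{\theta}{2}\right) + \sin \alpha}{\cos \left(\frac{\theta}{2}\right) - \sin \left(\frac{\theta}{2}\right)} \right) \cdot |u w|.\]
   Context: $P$ is a finite set of points in the plane and $S$ is a set of line segments (called constraints), each joining two points of $P$, such that no two constraints intersect properly. Two points $u,v\in P$ can see each other if and only if the segment $uv$ does not properly intersect any constraint or $uv$ is itself a constraint. Fix an integer $k\ge 1$, $x\in\{2,3,4,5\}$ and $\theta=2\pi/(4k+x)$. Around each point $u$, the $4k+x$ rays from $u$ with angle $\theta$ between consecutive rays define cones; they are oriented so that the bisector of one cone, $C_0^u$, is the vertical half-line above $u$, and the cones are numbered $C_0^u, C_1^u, \dots$ clockwise; all points use the same orientation. For every constraint $uv$ with $v\in C_i^u$, the line through that constraint splits $C_i^u$; the resulting pieces are the subcones of $C_i^u$ (if a constraint $uv$ splits a cone of $u$ into two subcones, $v$ is considered to lie in both; a cone not split is a single subcone). The constrained $\theta_{(4k+x)}$-graph has vertex set $P$ and, for each vertex $u$ and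 each subcone of each cone $C_i^u$, an edge between $u$ and the vertex $v$ of that subcone that can see $u$ and whose orthogonal projection onto the bisector of the full cone $C_i^u$ (not of the subcone) is closest to $u$ among all vertices of that subcone that can see $u$. Edges are weighted by Euclidean length, and the length of a path is the sum of its edge lengths. General position: no two points lie on a line parallel to one of the rays defining the cones, no two points lie on a line perpendicular to the bisector of a cone, and no three points are collinear. For a vertex $w$ in cone $C_i^u$, the canonical triangle $T_{uw}$ is the triangle bounded by the two boundary rays of $C_i^u$ and the line through $w$ perpendicular to the bisector of $C_i^u$. *)

theory Defs
  imports "HOL-Analysis.Analysis"
begin

text \<open>Points of the plane are complex numbers. Constraints are unordered pairs
  (two-element sets) of points. The number of cones is n = 4k + x.\<close>

definition cone_angle :: "nat \<Rightarrow> real" where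
  "cone_angle n = 2 * pi / real n"

text \<open>Unit vector along the bisector of cone C_i (C_0 points vertically up,
  cones are numbered clockwise).\<close>
definition bisector :: "nat \<Rightarrow> nat \<Rightarrow> complex" where
  "bisector n i = cis (pi / 2 - real i * cone_angle n)"

definition cone_lo :: "nat \<Rightarrow> nat \<Rightarrow> real" where
  "cone_lo n i = pi / 2 - real i * cone_angle n - cone_angle n / 2"

definition in_cone :: "nat \<Rightarrow> complex \<Rightarrow> nat \<Rightarrow> complex \<Rightarrow> bool" where
  "in_cone n u i v \<longleftrightarrow> i < n \<and> v \<noteq> u \<and>
     (\<exists>\<phi>. cone_lo n i \<le> \<phi> \<and> \<phi> < cone_lo n i + cone_angle n \<and>
          v - u = complex_of_real (cmod (v - u)) * cis \<phi>)"

definition dir_in_cone :: "nat \<Rightarrow> complex \<Rightarrow> nat \<Rightarrow> complex \<Rightarrow> real" where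
  "dir_in_cone n u i v = (THE \<phi>. cone_lo n i \<le> \<phi> \<and> \<phi> < cone_lo n i + cone_angle n \<and>
          v - u = complex_of_real (cmod (v - u)) * cis \<phi>)"

definition proj_bis :: "nat \<Rightarrow> complex \<Rightarrow> nat \<Rightarrow> complex \<Rightarrow> real" where
  "proj_bis n u i v = inner (v - u) (bisector n i)"

definition properly_intersect :: "complex \<Rightarrow> complex \<Rightarrow> complex \<Rightarrow> complex \<Rightarrow> bool" where
  "properly_intersect a b c d \<longleftrightarrow> open_segment a b \<inter> open_segment c d \<noteq> {}"

definition valid_constraints :: "complex set \<Rightarrow> complex set set \<Rightarrow> bool" where
  "valid_constraints P S \<longleftrightarrow>
     (\<forall>s\<in>S. \<exists>a b. a \<in> P \<and> b \<in> P \<and> a \<noteq> b \<and> s = {a, b}) \<and>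
     (\<forall>a b c d. {a, b} \<in> S \<longrightarrow> {c, d} \<in> S \<longrightarrow> {a, b} \<noteq> {c, d} \<longrightarrow> \<not> properly_intersect a b c d)"

definition sees :: "complex set set \<Rightarrow> complex \<Rightarrow> complex \<Rightarrow> bool" where
  "sees S u v \<longleftrightarrow> {u, v} \<in> S \<or> (\<forall>a b. {a, b} \<in> S \<longrightarrow> \<not> properly_intersect u v a b)"

definition split_angles :: "nat \<Rightarrow> complex set set \<Rightarrow> complex \<Rightarrow> nat \<Rightarrow> real set" where
  "split_angles n S u i =
     {cone_lo n i, cone_lo n i + cone_angle n} \<union>
     {dir_in_cone n u i c | c. {u, c} \<in> S \<and> in_cone n u i c}"

definition is_subcone :: "nat \<Rightarrow> complex set set \<Rightarrow> complex \<Rightarrow> nat \<Rightarrow> real \<Rightarrow> real \<Rightarrow> bool" where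
  "is_subcone n S u i a b \<longleftrightarrow> a \<in> split_angles n S u i \<and> b \<in> split_angles n S u i \<and> a < b \<and>
     \<not> (\<exists>d\<in>split_angles n S u i. a < d \<and> d < b)"

text \<open>Points of a subcone (a point on a splitting constraint lies in both adjacent subcones).\<close>
definition subcone_pts :: "nat \<Rightarrow> complex \<Rightarrow> nat \<Rightarrow> real \<Rightarrow> real \<Rightarrow> complex set" where
  "subcone_pts n u i a b = {v. in_cone n u i v \<and> a \<le> dir_in_cone n u i v \<and> dir_in_cone n u i v \<le> b}"

definition theta_selects :: "nat \<Rightarrow> complex set \<Rightarrow> complex set set \<Rightarrow> complex \<Rightarrow> complex \<Rightarrow> bool" where
  "theta_selects n P S u v \<longleftrightarrow> u \<in> P \<and> v \<in> P \<and>
     (\<exists>i<n. \<exists>a b. is_subcone n S u i a b \<and> v \<in> subcone_pts n u i a b \<and> sees S u v \<and>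
        (\<forall>x\<in>P. x \<in> subcone_pts n u i a b \<longrightarrow> sees S u x \<longrightarrow>
            proj_bis n u i v \<le> proj_bis n u i x))"

definition theta_edge :: "nat \<Rightarrow> complex set \<Rightarrow> complex set set \<Rightarrow> complex \<Rightarrow> complex \<Rightarrow> bool" where
  "theta_edge n P S u v \<longleftrightarrow> theta_selects n P S u v \<or> theta_selects n P S v u"

definition is_path :: "nat \<Rightarrow> complex set \<Rightarrow> complex set set \<Rightarrow> complex list \<Rightarrow> complex \<Rightarrow> complex \<Rightarrow> bool" where
  "is_path n P S xs u w \<longleftrightarrow> xs \<noteq> [] \<and> hd xs = u \<and> last xs = w \<and>
     (\<forall>j. Suc j < length xs \<longrightarrow> theta_edge n P S (xs ! j) (xs ! Suc j))"

definition path_length :: "complex list \<Rightarrow> real" where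
  "path_length xs = (\<Sum>j<length xs - 1. dist (xs ! j) (xs ! Suc j))"

definition general_position :: "nat \<Rightarrow> complex set \<Rightarrow> bool" where
  "general_position n P \<longleftrightarrow>
     (\<forall>a\<in>P. \<forall>b\<in>P. a \<noteq> b \<longrightarrow>
        (\<forall>j::nat. Im ((b - a) * cnj (cis (pi / 2 - (real j + 1/2) * cone_angle n))) \<noteq> 0) \<and>
        (\<forall>j::nat. Im ((b - a) * cnj (\<i> * bisector n j)) \<noteq> 0)) \<and>
     (\<forall>a\<in>P. \<forall>b\<in>P. \<forall>c\<in>P. a \<noteq> b \<and> b \<noteq> c \<and> a \<noteq> c \<longrightarrow> \<not> collinear {a, b, c})"

text \<open>Midpoint of the side of the canonical triangle T_uw opposite u (w in C_i^u):
  the foot of the bisector on the line through w perpendicular to it.\<close>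
definition canon_mid :: "nat \<Rightarrow> complex \<Rightarrow> nat \<Rightarrow> complex \<Rightarrow> complex" where
  "canon_mid n u i w = u + complex_of_real (proj_bis n u i w) * bisector n i"

definition vec_angle :: "complex \<Rightarrow> complex \<Rightarrow> real" where
  "vec_angle x y = arccos (inner x y / (norm x * norm y))"

end

theory Submission
  imports Defs
begin

text \<open>
  Write \<open>t = \<theta> / 2\<close> and \<open>c = 1 / (cos t - sin t)\<close>. Since \<open>1 / cos t + c tan t = c\<close>, the claimed bound
  equals \<open>c\<close> times the L1 norm of \<open>w - u\<close> in the orthogonal frame given by the bisector of the cone
  of \<open>u\<close> containing \<open>w\<close>. With \<open>4k + 4\<close> cones, a rotation by \<open>\<pi> / 2\<close> permutes the bisectors, and
  therefore the frame of the cone containing a vector minimises its L1 norm among all these frames.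

  Induct on the distance of \<open>u\<close> and \<open>w\<close>. Let \<open>v\<close> be the neighbour of \<open>u\<close> in the subcone of \<open>w\<close>. The
  points of \<open>P\<close> other than \<open>u\<close> in the triangle \<open>uvw\<close> lie in the triangle \<open>vow\<close>, where \<open>o\<close> is the point
  of \<open>uw\<close> with the same projection onto the bisector as \<open>v\<close>. The part of their convex hull facing \<open>u\<close> is a
  chain of visibility edges from \<open>v\<close> to \<open>w\<close>, all shorter than \<open>uw\<close>, whose length in any norm is at
  most that of the path \<open>v, o, w\<close>. Applying the induction hypothesis to its edges, measured in the frame
  of \<open>u\<close>, and using \<open>|uv| \<le> c (X - |Y|)\<close> for the coordinates \<open>X, Y\<close> of \<open>v - u\<close> in that frame, gives the bound.
\<close>

subsection \<open>Visibility in triangles\<close>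

text \<open>The 2x2 determinant of two plane vectors, that is, twice the signed area of the triangle
  they span.\<close>

definition crs :: "complex \<Rightarrow> complex \<Rightarrow> real" where
  "crs a b = Re a * Im b - Im a * Re b"

text \<open>
  The coefficient of \<open>v - u\<close> when \<open>p - u\<close> is expanded in \<open>v - u\<close> and \<open>w - u\<close>; the coefficient of
  \<open>w - u\<close> is \<open>bary u w v p\<close>. Both are 0 when \<open>u, v, w\<close> are collinear.
\<close>

definition bary :: "complex \<Rightarrow> complex \<Rightarrow> complex \<Rightarrow> complex \<Rightarrow> real" where
  "bary u v w p = crs (p - u) (w - u) / crs (v - u) (w - u)"

text \<open>For non-collinear \<open>u, v, w\<close> this is the closed triangle. In the collinear
  case both coefficients default to 0 and every point qualifies, so the lemmas carry a nonvanishing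
  \<open>crs\<close>.\<close>

definition in_tri :: "complex \<Rightarrow> complex \<Rightarrow> complex \<Rightarrow> complex \<Rightarrow> bool" where
  "in_tri u v w p \<longleftrightarrow> 0 \<le> bary u v w p \<and> 0 \<le> bary u w v p \<and> bary u v w p + bary u w v p \<le> 1"

lemma crs_swap: "crs b a = - crs a b"
  by (simp add: crs_def)

text \<open>Cramer's rule, checked coordinatewise after clearing the denominator \<open>d\<close>;
  the second coefficient has denominator \<open>- d\<close> by antisymmetry of
  \<open>crs\<close>.\<close>

lemma bary_decomp:
  assumes "crs (v - u) (w - u) \<noteq> 0"
  shows "p = u + bary u v w p *\<^sub>R (v - u) + bary u w v p *\<^sub>R (w - u)"
proof -
  define d where "d = crs (v - u) (w - u)"
  have d: "d \<noteq> 0" "crs (w - u) (v - u) = - d"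
    using assms by (auto simp: d_def crs_swap[of "w - u"])
  have "d * Re (p - u) = crs (p - u) (w - u) * Re (v - u) - crs (p - u) (v - u) * Re (w - u)"
    "d * Im (p - u) = crs (p - u) (w - u) * Im (v - u) - crs (p - u) (v - u) * Im (w - u)"
    unfolding d_def crs_def by (simp_all add: algebra_simps)
  moreover have solve: "X = A / d * x + B / - d * y" if "d * X = A * x - B * y" for X A B x y :: real
    using that d(1) by (simp add: field_simps)
  ultimately have "Re (p - u) = bary u v w p * Re (v - u) + bary u w v p * Re (w - u)"
    "Im (p - u) = bary u v w p * Im (v - u) + bary u w v p * Im (w - u)"
    using solve unfolding bary_def d_def[symmetric] d(2) by blast+
  then show ?thesis
    by (simp add: complex_eq_iff algebra_simps)
qed

lemma bary_unique:
  assumes "crs (v - u) (w - u) \<noteq> 0" "p = u + s *\<^sub>R (v - u) + r *\<^sub>R (w - u)"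
  shows "bary u v w p = s" "bary u w v p = r"
proof -
  have "crs (p - u) (w - u) = s * crs (v - u) (w - u)"
    "crs (p - u) (v - u) = r * crs (w - u) (v - u)"
    unfolding assms(2) by (simp_all add: crs_def algebra_simps)
  then show "bary u v w p = s" "bary u w v p = r"
    using assms(1) crs_swap[of "w - u" "v - u"] by (simp_all add: bary_def)
qed

text \<open>Affinity along segments allows the point where a constraint leaves a triangle to be
  found by interpolating the coordinates of its endpoints.\<close>

lemma bary_affine:
  "bary u v w ((1 - t) *\<^sub>R a + t *\<^sub>R b) = (1 - t) * bary u v w a + t * bary u v w b"
proof -
  have "crs ((1 - t) *\<^sub>R a + t *\<^sub>R b - u) (w - u) =
     (1 - t) * crs (a - u) (w - u) + t * crs (b - u) (w - u)"
    by (simp add: crs_def algebra_simps)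
  then show ?thesis by (simp add: bary_def add_divide_distrib)
qed

lemma bary_self [simp]:
  "bary u v w u = 0" "bary u v w w = 0" "crs (v - u) (w - u) \<noteq> 0 \<Longrightarrow> bary u v w v = 1"
  by (simp_all add: bary_def crs_def)

text \<open>Expand \<open>c - a\<close> in \<open>b - a\<close> and its quarter turn: the inner
  product yields the first coefficient and \<open>crs\<close> the second, so only a multiple of
  \<open>b - a\<close> remains.\<close>

lemma collinear_crs:
  assumes "crs (b - a) (c - a) = 0"
  shows "collinear {a, b, c}"
proof (cases "b = a")
  case False
  define d where "d = (norm (b - a))\<^sup>2"
  have d: "d > 0" using False by (simp add: d_def)
  define s where "s = inner (c - a) (b - a) / d"
  have dd: "d = (Re (b - a))\<^sup>2 + (Im (b - a))\<^sup>2" by (simp add: d_def cmod_power2)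
  have "d * Re (c - a) = inner (c - a) (b - a) * Re (b - a) - crs (b - a) (c - a) * Im (b - a)"
    "d * Im (c - a) = inner (c - a) (b - a) * Im (b - a) + crs (b - a) (c - a) * Re (b - a)"
    unfolding dd crs_def inner_complex_def by (simp_all add: algebra_simps power2_eq_square)
  then have "Re (c - a) = s * Re (b - a)" "Im (c - a) = s * Im (b - a)"
    using d assms by (simp_all add: s_def field_simps)
  then have "c - a = s *\<^sub>R (b - a)" by (simp add: complex_eq_iff)
  then have "c = a + s *\<^sub>R (b - a)" by (simp add: algebra_simps)
  then have "\<forall>x\<in>{a,b,c}. \<exists>t. x = a + t *\<^sub>R (b - a)"
    by (auto intro: exI[of _ 0] exI[of _ 1])
  then show ?thesis unfolding collinear_alt by blast
qed simp

section \<open>Constraints crossing a triangle with apex u\<close>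

locale constrained_points =
  fixes P :: "complex set" and S :: "complex set set"
  assumes finite_P: "finite P"
    and valid: "valid_constraints P S"
    and noncollinear: "\<And>a b c. \<lbrakk>a \<in> P; b \<in> P; c \<in> P; a \<noteq> b; b \<noteq> c; a \<noteq> c\<rbrakk> \<Longrightarrow> \<not> collinear {a, b, c}"
begin

lemma crs_eq_0D:
  assumes "a \<in> P" "b \<in> P" "c \<in> P" "crs (b - a) (c - a) = 0"
  shows "a = b \<or> b = c \<or> a = c"
  using noncollinear[OF assms(1-3)] collinear_crs[OF assms(4)] by blast

lemma constraint_endpoints:
  assumes "{a, b} \<in> S"
  shows "a \<in> P" "b \<in> P" "a \<noteq> b"
proof -
  have "\<exists>a' b'. a' \<in> P \<and> b' \<in> P \<and> a' \<noteq> b' \<and> {a, b} = {a', b'}"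
    using bspec[OF conjunct1[OF valid[unfolded valid_constraints_def]] assms] .
  then have "a \<in> P \<and> b \<in> P \<and> a \<noteq> b" by (auto simp: doubleton_eq_iff)
  then show "a \<in> P" "b \<in> P" "a \<noteq> b" by simp_all
qed

text \<open>If \<open>uv\<close> is itself a constraint, validity forbids another constraint to
  cross it; otherwise visibility does.\<close>

lemma crossing_visible:
  assumes "sees S u v" "{a, b} \<in> S" "e \<in> open_segment u v" "e \<in> open_segment a b"
  shows "{a, b} = {u, v}"
proof (rule ccontr)
  assume neq: "{a, b} \<noteq> {u, v}"
  have int: "properly_intersect u v a b" using assms(3,4) unfolding properly_intersect_def by blast
  show False
  proof (cases "{u, v} \<in> S")
    case True
    have "\<not> properly_intersect u v a b"
      using conjunct2[OF valid[unfolded valid_constraints_def], rule_format, OF True assms(2)] neq by simp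
    then show False using int by simp
  next
    case False
    then show False using assms(1,2) int unfolding sees_def by blast
  qed
qed

text \<open>A constraint through \<open>z\<close> that leaves the triangle at \<open>e\<close> on
  the open side \<open>uv\<close> crosses a visible segment in its interior, hence coincides with
  it.\<close>

lemma exit_crossing:
  assumes D: "crs (v - u) (w - u) \<noteq> 0" and vis: "sees S u v" and ab: "{a, b} \<in> S"
    and \<mu>: "0 < \<mu>" "\<mu> < 1" and \<sigma>: "0 < \<sigma>" "\<sigma> < 1"
    and z: "z = (1 - \<mu>) *\<^sub>R a + \<mu> *\<^sub>R b" and e: "e = (1 - \<sigma>) *\<^sub>R z + \<sigma> *\<^sub>R a"
    and "bary u w v e = 0" "0 < bary u v w e" "bary u v w e < 1"
  shows "{a, b} = {u, v}"
proof (rule crossing_visible[OF vis ab])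
  have "e = u + bary u v w e *\<^sub>R (v - u)" using bary_decomp[OF D, of e] assms(10) by simp
  then have "e = (1 - bary u v w e) *\<^sub>R u + bary u v w e *\<^sub>R v" by (simp add: algebra_simps)
  moreover have "u \<noteq> v" using D by (auto simp: crs_def)
  ultimately show "e \<in> open_segment u v" using assms(11,12) by (metis in_segment(2))
  have "e = (1 - (1 - \<sigma>) * \<mu>) *\<^sub>R a + ((1 - \<sigma>) * \<mu>) *\<^sub>R b"
    unfolding e z by (simp add: algebra_simps)
  moreover have "0 < (1 - \<sigma>) * \<mu>" using \<mu> \<sigma> by simp
  moreover have "(1 - \<sigma>) * \<mu> < 1" using \<mu> \<sigma>
    by (smt (verit) mult_less_cancel_right2)
  ultimately show "e \<in> open_segment a b" using constraint_endpoints[OF ab] by (metis in_segment(2))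
qed

text \<open>Here \<open>(s0, r0)\<close> are the coordinates of a point \<open>q\<close>,
  \<open>z\<close> divides \<open>uq\<close> in the ratio given by \<tau>, and
  \<open>\<alpha> * s + \<beta> * r\<close> is a height below which the triangle contains no point
  of \<open>P\<close> except \<open>u\<close>. The endpoint \<open>a\<close> is below height 1 and
  on the side of \<open>uq\<close> containing \<open>v\<close>, so it lies beyond \<open>uv\<close>.
  The piece from \<open>z\<close> to \<open>a\<close> then crosses \<open>uv\<close>, so the
  constraint is \<open>uv\<close>, whose endpoints do not lie beyond it.\<close>

lemma lowest_not_crossed:
  assumes D: "crs (v - u) (w - u) \<noteq> 0" and vis: "sees S u v" and ab: "{a, b} \<in> S"
    and \<mu>: "0 < \<mu>" "\<mu> < 1" and z: "z = (1 - \<mu>) *\<^sub>R a + \<mu> *\<^sub>R b"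
    and zc: "bary u v w z = \<tau> * s0" "bary u w v z = \<tau> * r0" "0 < \<tau>" "\<tau> < 1" "0 < s0" "0 < r0"
    and low: "\<alpha> * s0 + \<beta> * r0 \<le> 1" "1 \<le> \<alpha>" "1 \<le> \<beta>"
      "\<And>p. \<lbrakk>p \<in> P; p \<noteq> u; in_tri u v w p\<rbrakk> \<Longrightarrow> 1 \<le> \<alpha> * bary u v w p + \<beta> * bary u w v p"
    and a: "\<alpha> * bary u v w a + \<beta> * bary u w v a < 1" "bary u w v a * s0 < bary u v w a * r0"
  shows False
proof -
  define sa ra where "sa = bary u v w a" and "ra = bary u w v a"
  have aP: "a \<in> P" using constraint_endpoints[OF ab] by blast
  have au: "a \<noteq> u" using a(2) by auto
  \<comment> \<open>Otherwise both coordinates are nonnegative, and \<alpha>, \<beta> \<ge> 1 bound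
    their sum by the height, placing \<open>a\<close> in the triangle below height 1.\<close>
  have "ra < 0"
  proof (rule ccontr)
    assume "\<not> ra < 0"
    then have ra: "0 \<le> ra" by simp
    then have "0 < sa * r0" using a(2) zc(5) by (smt (verit) sa_def ra_def mult_nonneg_nonneg)
    then have sa: "0 < sa" using zc(6) by (simp add: zero_less_mult_iff)
    have "sa \<le> \<alpha> * sa" "ra \<le> \<beta> * ra" using sa ra low(2,3) by (simp_all add: mult_le_cancel_right1)
    then have "in_tri u v w a" using sa ra a(1) unfolding in_tri_def sa_def ra_def by linarith
    then show False using low(4)[OF aP au] a(1) by simp
  qed
  define rz where "rz = \<tau> * r0"
  \<comment> \<open>The parameter at which the \<open>w - u\<close> coordinate, interpolated from
    \<open>z\<close> to \<open>a\<close>, vanishes.\<close>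
  define \<sigma> where "\<sigma> = rz / (rz - ra)"
  have rz: "rz > 0" using zc by (simp add: rz_def)
  have \<sigma>: "0 < \<sigma>" "\<sigma> < 1" using rz \<open>ra < 0\<close> by (simp_all add: \<sigma>_def)
  define e where "e = (1 - \<sigma>) *\<^sub>R z + \<sigma> *\<^sub>R a"
  have re: "bary u w v e = (1 - \<sigma>) * rz + \<sigma> * ra" and se: "bary u v w e = (1 - \<sigma>) * (\<tau> * s0) + \<sigma> * sa"
    unfolding e_def by (simp_all add: bary_affine zc sa_def ra_def rz_def)
  have re0: "bary u w v e = 0" unfolding re \<sigma>_def using rz \<open>ra < 0\<close> by (simp add: field_simps)
  \<comment> \<open>The expression on the left is affine and vanishes at \<open>z\<close>, so
    \<open>e\<close> inherits its sign from \<open>a\<close>: the exit point is on the ray from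
    \<open>u\<close> through \<open>v\<close>.\<close>
  have "bary u v w e * r0 - bary u w v e * s0 = \<sigma> * (sa * r0 - ra * s0)"
    unfolding re se rz_def by (simp add: algebra_simps)
  also have "\<dots> > 0" using a(2) \<sigma> by (simp add: sa_def ra_def)
  finally have se0: "0 < bary u v w e" using re0 zc(6) by (simp add: zero_less_mult_iff)
  have "\<alpha> * bary u v w e + \<beta> * bary u w v e
      = (1 - \<sigma>) * (\<tau> * (\<alpha> * s0 + \<beta> * r0)) + \<sigma> * (\<alpha> * sa + \<beta> * ra)"
    unfolding re se rz_def by (simp add: algebra_simps)
  also have "\<dots> < (1 - \<sigma>) * 1 + \<sigma> * 1"
  proof (rule add_le_less_mono)
    have "\<tau> * (\<alpha> * s0 + \<beta> * r0) \<le> \<tau> * 1" using low(1) zc(3) by (intro mult_left_mono) auto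
    then show "(1 - \<sigma>) * (\<tau> * (\<alpha> * s0 + \<beta> * r0)) \<le> (1 - \<sigma>) * 1"
      using \<sigma> zc(4) by (intro mult_left_mono) auto
    show "\<sigma> * (\<alpha> * sa + \<beta> * ra) < \<sigma> * 1"
      using \<sigma> a(1) unfolding sa_def ra_def by (intro mult_strict_left_mono) auto
  qed
  finally have "\<alpha> * bary u v w e < 1" using re0 by simp
  moreover have "bary u v w e \<le> \<alpha> * bary u v w e" using se0 low(2) by (simp add: mult_le_cancel_right1)
  ultimately have "bary u v w e < 1" by linarith
  from exit_crossing[OF D vis ab \<mu> \<sigma> z e_def re0 se0 this] have "{a, b} = {u, v}" .
  then have "a = v" using au by (auto simp: doubleton_eq_iff)
  then show False using \<open>ra < 0\<close> by (simp add: ra_def)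
qed

text \<open>
  No point of the triangle other than \<open>u\<close> is strictly on the side of \<open>u\<close> of a line through \<open>q\<close>; so a constraint
  crossing \<open>uq\<close> has an endpoint outside the triangle and leaves it through \<open>uv\<close> or \<open>uw\<close>.
\<close>

lemma sees_lowest:
  assumes P: "u \<in> P" "v \<in> P" "w \<in> P" "q \<in> P" and D: "crs (v - u) (w - u) \<noteq> 0"
    and vis: "sees S u v" "sees S u w"
    and q: "q \<noteq> u" "in_tri u v w q" "\<alpha> * bary u v w q + \<beta> * bary u w v q \<le> 1"
    and low: "\<And>p. \<lbrakk>p \<in> P; p \<noteq> u; in_tri u v w p\<rbrakk> \<Longrightarrow> 1 \<le> \<alpha> * bary u v w p + \<beta> * bary u w v p"
  shows "sees S u q"
proof -
  define s0 r0 where "s0 = bary u v w q" and "r0 = bary u w v q"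
  have D': "crs (w - u) (v - u) \<noteq> 0" using D crs_swap[of "w - u"] by simp
  have uvw: "u \<noteq> v" "u \<noteq> w" using D by (auto simp: crs_def)
  have tri: "in_tri u v w v" "in_tri u v w w" using D D' by (auto simp: in_tri_def)
  \<comment> \<open>The vertices \<open>v\<close> and \<open>w\<close> lie in the triangle and have
    heights \<alpha> and \<beta>.\<close>
  have \<alpha>\<beta>: "1 \<le> \<alpha>" "1 \<le> \<beta>" using low[OF P(2) _ tri(1)] low[OF P(3) _ tri(2)] uvw D D' by auto
  have nn: "0 \<le> s0" "0 \<le> r0" using q(2) by (auto simp: in_tri_def s0_def r0_def)
  have qd: "q - u = s0 *\<^sub>R (v - u) + r0 *\<^sub>R (w - u)"
    using bary_decomp[OF D, of q] by (simp add: s0_def r0_def algebra_simps)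
  have low': "\<And>p. \<lbrakk>p \<in> P; p \<noteq> u; in_tri u w v p\<rbrakk> \<Longrightarrow> 1 \<le> \<beta> * bary u w v p + \<alpha> * bary u v w p"
    using low by (simp add: in_tri_def add.commute)
  show ?thesis
  proof (cases "s0 = 0 \<or> r0 = 0")
    case True
    \<comment> \<open>On a side of the triangle, non-collinearity leaves only \<open>q = v\<close>
      or \<open>q = w\<close>.\<close>
    then have "crs (w - u) (q - u) = 0 \<or> crs (v - u) (q - u) = 0" using qd by (auto simp: crs_def)
    then have "q = w \<or> q = v" using crs_eq_0D P q(1) uvw by metis
    then show ?thesis using vis by auto
  next
    case False
    then have pos: "0 < s0" "0 < r0" using nn by auto
    show ?thesis
    proof (rule ccontr)
      assume "\<not> sees S u q"
      then obtain a b where uq: "{u, q} \<notin> S" and ab: "{a, b} \<in> S" and "properly_intersect u q a b"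
        unfolding sees_def by blast
      then obtain z where z: "z \<in> open_segment u q" "z \<in> open_segment a b"
        unfolding properly_intersect_def by blast
      obtain \<tau> where \<tau>: "0 < \<tau>" "\<tau> < 1" "z = (1 - \<tau>) *\<^sub>R u + \<tau> *\<^sub>R q"
        using z(1) by (auto simp: in_segment)
      obtain \<mu> where \<mu>: "0 < \<mu>" "\<mu> < 1" "z = (1 - \<mu>) *\<^sub>R a + \<mu> *\<^sub>R b"
        using z(2) by (auto simp: in_segment)
      have \<mu>': "0 < 1 - \<mu>" "1 - \<mu> < 1" "z = (1 - (1 - \<mu>)) *\<^sub>R b + (1 - \<mu>) *\<^sub>R a"
        using \<mu> by (simp_all add: add.commute)
      have zc: "bary u v w z = \<tau> * s0" "bary u w v z = \<tau> * r0"
        unfolding \<tau>(3) bary_affine by (simp_all add: s0_def r0_def)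
      have abP: "a \<in> P" "b \<in> P" "a \<noteq> b" using constraint_endpoints[OF ab] by auto
      \<comment> \<open>The sign of \<open>F\<close> tells the side of the line \<open>uq\<close>,
        positive towards \<open>v\<close>; \<open>L\<close> is the height.\<close>
      define F where "F p = bary u v w p * r0 - bary u w v p * s0" for p
      define L where "L p = \<alpha> * bary u v w p + \<beta> * bary u w v p" for p
      have "F z = 0" by (simp add: F_def zc)
      moreover have "F z = (1 - \<mu>) * F a + \<mu> * F b"
        unfolding \<mu>(3) F_def bary_affine by (simp add: algebra_simps)
      ultimately have F: "(1 - \<mu>) * F a + \<mu> * F b = 0" by simp
      have F0: "p = u \<or> p = q" if "p \<in> P" "F p = 0" for p
      proof -
        have pd: "p - u = bary u v w p *\<^sub>R (v - u) + bary u w v p *\<^sub>R (w - u)"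
          using bary_decomp[OF D, of p] by (simp add: algebra_simps)
        have "crs (p - u) (q - u) = F p * crs (v - u) (w - u)"
          unfolding pd qd F_def by (simp add: crs_def algebra_simps)
        then show ?thesis using crs_eq_0D[OF P(1) that(1) P(4)] that(2) q(1) by auto
      qed
      have "F a \<noteq> 0"
      proof
        assume "F a = 0"
        then have "F b = 0" using F \<mu> by simp
        then have "{a, b} = {u, q}" using F0 \<open>F a = 0\<close> abP by auto
        then show False using ab uq by simp
      qed
      have "L z < 1"
      proof -
        have "L z = \<tau> * (\<alpha> * s0 + \<beta> * r0)" by (simp add: L_def zc algebra_simps)
        also have "\<dots> \<le> \<tau> * 1" using q(3) \<tau>(1) unfolding s0_def r0_def by (intro mult_left_mono) auto
        finally show ?thesis using \<tau>(2) by simp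
      qed
      moreover have "L z = (1 - \<mu>) * L a + \<mu> * L b"
        unfolding \<mu>(3) L_def bary_affine by (simp add: algebra_simps)
      ultimately have L1: "(1 - \<mu>) * L a + \<mu> * L b < 1" by simp
      have Lab: "L a < 1 \<or> L b < 1"
      proof (rule ccontr)
        assume "\<not> ?thesis"
        then have "(1 - \<mu>) * 1 \<le> (1 - \<mu>) * L a" "\<mu> * 1 \<le> \<mu> * L b"
          using \<mu> by (auto intro!: mult_left_mono simp del: mult_1_right)
        then show False using L1 by simp
      qed
      have ba: "{b, a} \<in> S" using ab by (simp add: insert_commute)
      have q3: "\<alpha> * s0 + \<beta> * r0 \<le> 1" "\<beta> * r0 + \<alpha> * s0 \<le> 1"
        using q(3) by (simp_all add: s0_def r0_def)
      \<comment> \<open>An endpoint of height below 1 is impossible on either side of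
        \<open>uq\<close>; the negative side follows by exchanging \<open>v\<close> and
        \<open>w\<close>. Since \<open>z\<close> has height below 1, one endpoint does too.\<close>
      have key: False if "F p \<noteq> 0" "L p < 1" "{p, p'} \<in> S" "0 < m" "m < 1" "z = (1 - m) *\<^sub>R p + m *\<^sub>R p'" for p p' m
      proof (cases "F p > 0")
        case True
        show False
          by (rule lowest_not_crossed[OF D vis(1) that(3-6) zc \<tau>(1,2) pos q3(1) \<alpha>\<beta> low])
            (use True that in \<open>auto simp: F_def L_def\<close>)
      next
        case False
        show False
          by (rule lowest_not_crossed[OF D' vis(2) that(3-6) zc(2,1) \<tau>(1,2) pos(2,1) q3(2) \<alpha>\<beta>(2,1) low'])
            (use False that in \<open>auto simp: F_def L_def\<close>)
      qed
      have "F b \<noteq> 0" using F \<mu> \<open>F a \<noteq> 0\<close> by auto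
      then show False using key[OF \<open>F a \<noteq> 0\<close> _ ab \<mu>] key[OF \<open>F b \<noteq> 0\<close> _ ba \<mu>'] Lab by blast
    qed
  qed
qed

text \<open>The same exit argument for a \<open>z\<close> that may lie on the base
  \<open>vw\<close>: below the base, \<open>a\<close> lies beyond \<open>uv\<close>, so the
  constraint leaves through \<open>uv\<close>. The side condition on \<open>a\<close> is weak here,
  so the exit point might be \<open>u\<close>.\<close>

lemma base_crossing_impossible:
  assumes D: "crs (v - u) (w - u) \<noteq> 0" and vis: "sees S u v" and ab: "{a, b} \<in> S" and uP: "u \<in> P"
    and au: "a \<noteq> u" "b \<noteq> u"
    and \<mu>: "0 < \<mu>" "\<mu> < 1" and z: "z = (1 - \<mu>) *\<^sub>R a + \<mu> *\<^sub>R b"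
    and zc: "0 < bary u v w z" "0 < bary u w v z" "bary u v w z + bary u w v z \<le> 1"
    and a: "bary u v w a + bary u w v a < 1" "bary u w v a < 0"
      "0 \<le> bary u v w a * bary u w v z - bary u w v a * bary u v w z"
  shows False
proof -
  define sa ra sz rz where "sa = bary u v w a" and "ra = bary u w v a"
    and "sz = bary u v w z" and "rz = bary u w v z"
  note defs = sa_def ra_def sz_def rz_def
  define \<sigma> where "\<sigma> = rz / (rz - ra)"
  have \<sigma>: "0 < \<sigma>" "\<sigma> < 1" using zc a by (simp_all add: \<sigma>_def defs)
  define e where "e = (1 - \<sigma>) *\<^sub>R z + \<sigma> *\<^sub>R a"
  have re: "bary u w v e = (1 - \<sigma>) * rz + \<sigma> * ra" and se: "bary u v w e = (1 - \<sigma>) * sz + \<sigma> * sa"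
    unfolding e_def by (simp_all add: bary_affine defs)
  have den: "rz - ra > 0" using zc a by (simp add: defs)
  have re0: "bary u w v e = 0" unfolding re \<sigma>_def using den by (simp add: field_simps)
  have "bary u v w e = (sa * rz - ra * sz) / (rz - ra)"
  proof -
    have "1 - \<sigma> = - ra / (rz - ra)" using den by (simp add: \<sigma>_def field_simps)
    then show ?thesis unfolding se by (simp add: \<sigma>_def diff_divide_distrib)
  qed
  then have se0: "0 \<le> bary u v w e" using a(3) den by (simp add: defs)
  have "bary u v w e + bary u w v e = (1 - \<sigma>) * (sz + rz) + \<sigma> * (sa + ra)"
    unfolding re se by (simp add: algebra_simps)
  also have "\<dots> < (1 - \<sigma>) * 1 + \<sigma> * 1"
    by (rule add_le_less_mono; (rule mult_left_mono | rule mult_strict_left_mono))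
      (use \<sigma> zc a in \<open>auto simp: defs\<close>)
  finally have se1: "bary u v w e < 1" using re0 by simp
  \<comment> \<open>An exit at \<open>u\<close> would make \<open>u\<close>, \<open>a\<close>,
    \<open>b\<close> three distinct collinear points.\<close>
  have "bary u v w e \<noteq> 0"
  proof
    assume "bary u v w e = 0"
    then have "e = u" using bary_decomp[OF D, of e] re0 by simp
    then have "u = a + ((1 - \<sigma>) * \<mu>) *\<^sub>R (b - a)" unfolding e_def z by (simp add: algebra_simps)
    then obtain t where t: "u = a + t *\<^sub>R (b - a)" by blast
    have "crs (a - u) (b - u) = 0" unfolding t by (simp add: crs_def algebra_simps)
    then show False using crs_eq_0D[OF uP constraint_endpoints(1,2)[OF ab]] au constraint_endpoints(3)[OF ab] by auto
  qed
  then have "0 < bary u v w e" using se0 by simp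
  from exit_crossing[OF D vis ab \<mu> \<sigma> z e_def re0 this se1] have "{a, b} = {u, v}" .
  then show False using au by (auto simp: doubleton_eq_iff)
qed

text \<open>A constraint crossing \<open>vx\<close> has an endpoint on the side of \<open>u\<close>.
  It is not in the empty triangle, and it is not \<open>u\<close> since no constraint at
  \<open>u\<close> enters the angle; so the constraint leaves through \<open>uv\<close> or
  \<open>ux\<close>, which are visible.\<close>

lemma sees_base:
  assumes P: "u \<in> P" "v \<in> P" "x \<in> P" and D: "crs (v - u) (x - u) \<noteq> 0"
    and vis: "sees S u v" "sees S u x"
    and empty: "\<And>p. \<lbrakk>p \<in> P; in_tri u v x p\<rbrakk> \<Longrightarrow> p = u \<or> p = v \<or> p = x"
    and nocon: "\<And>c. {u, c} \<in> S \<Longrightarrow> \<not> (0 < bary u v x c \<and> 0 < bary u x v c)"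
  shows "sees S v x"
proof (rule ccontr)
  assume "\<not> sees S v x"
  then obtain a b where vx: "{v, x} \<notin> S" and ab: "{a, b} \<in> S" and "properly_intersect v x a b"
    unfolding sees_def by blast
  then obtain z where z: "z \<in> open_segment v x" "z \<in> open_segment a b"
    unfolding properly_intersect_def by blast
  obtain \<tau> where \<tau>: "0 < \<tau>" "\<tau> < 1" "z = (1 - \<tau>) *\<^sub>R v + \<tau> *\<^sub>R x"
    using z(1) by (auto simp: in_segment)
  obtain \<mu> where \<mu>: "0 < \<mu>" "\<mu> < 1" "z = (1 - \<mu>) *\<^sub>R a + \<mu> *\<^sub>R b"
    using z(2) by (auto simp: in_segment)
  have \<mu>': "0 < 1 - \<mu>" "1 - \<mu> < 1" "z = (1 - (1 - \<mu>)) *\<^sub>R b + (1 - \<mu>) *\<^sub>R a"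
    using \<mu> by (simp_all add: add.commute)
  have D': "crs (x - u) (v - u) \<noteq> 0" using D crs_swap[of "x - u"] by simp
  have zc: "bary u v x z = 1 - \<tau>" "bary u x v z = \<tau>"
    unfolding \<tau>(3) bary_affine using D D' by simp_all
  have abP: "a \<in> P" "b \<in> P" "a \<noteq> b" using constraint_endpoints[OF ab] by auto
  have ba: "{b, a} \<in> S" using ab by (simp add: insert_commute)
  have vnx: "v \<noteq> x" using D by (auto simp: crs_def)
  \<comment> \<open>\<open>L\<close> is 0 at \<open>u\<close> and 1 exactly on the line
    \<open>vx\<close>.\<close>
  define L where "L p = bary u v x p + bary u x v p" for p
  have L: "1 = (1 - \<mu>) * L a + \<mu> * L b"
  proof -
    have "L z = (1 - \<mu>) * L a + \<mu> * L b" unfolding \<mu>(3) L_def bary_affine by (simp add: algebra_simps)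
    then show ?thesis by (simp add: L_def zc)
  qed
  have L1: "p = v \<or> p = x" if "p \<in> P" "L p = 1" for p
  proof -
    have s: "bary u v x p = 1 - bary u x v p" using that(2) by (simp add: L_def)
    have "p - v = bary u x v p *\<^sub>R (x - v)"
      using bary_decomp[OF D, of p] unfolding s by (simp add: algebra_simps)
    then have "crs (p - v) (x - v) = 0" by (simp add: crs_def)
    then show ?thesis using crs_eq_0D[OF P(2) that(1) P(3)] vnx by auto
  qed
  have La: "L a \<noteq> 1"
  proof
    assume "L a = 1"
    then have "\<mu> * L b = \<mu>" using L by simp
    then have "L b = 1" using \<mu> by simp
    then have "{a, b} = {v, x}" using L1 \<open>L a = 1\<close> abP by auto
    then show False using ab vx by simp
  qed
  have key: False if "L p < 1" "{p, p'} \<in> S" "0 < m" "m < 1" "z = (1 - m) *\<^sub>R p + m *\<^sub>R p'" for p p' m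
  proof -
    have pP: "p \<in> P" using constraint_endpoints[OF that(2)] by auto
    have bz: "bary u v' x' z = (1 - m) * bary u v' x' p + m * bary u v' x' p'" for v' x'
      unfolding that(5) bary_affine ..
    \<comment> \<open>If one end were \<open>u\<close>, the other would lie on the ray from
      \<open>u\<close> through \<open>z\<close>, so both its coordinates would be positive, contrary
      to \<open>nocon\<close>.\<close>
    have pu: "p \<noteq> u"
    proof
      assume "p = u"
      then have "0 < m * bary u v x p'" "0 < m * bary u x v p'" using bz zc \<tau> by (auto simp del: mult_less_0_iff)
      then have "0 < bary u v x p'" "0 < bary u x v p'" using that(3) by (auto simp: zero_less_mult_iff)
      then show False using nocon that(2) \<open>p = u\<close> by blast
    qed
    have p'u: "p' \<noteq> u"
    proof
      assume "p' = u"
      then have "0 < (1 - m) * bary u v x p" "0 < (1 - m) * bary u x v p" using bz zc \<tau> by auto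
      then have "0 < bary u v x p" "0 < bary u x v p" using that(4) by (auto simp: zero_less_mult_iff)
      then show False using nocon that(2) \<open>p' = u\<close> by (simp add: insert_commute)
    qed
    have "\<not> in_tri u v x p"
    proof
      assume "in_tri u v x p"
      then have "p = v \<or> p = x" using empty pP pu by blast
      then have "L p = 1" using D D' by (auto simp: L_def)
      then show False using that(1) by simp
    qed
    then have neg: "bary u v x p < 0 \<or> bary u x v p < 0" using that(1) by (auto simp: in_tri_def L_def)
    \<comment> \<open>The side of the line \<open>uz\<close> on which \<open>p\<close> lies; it
      decides whether the constraint leaves through \<open>uv\<close> or \<open>ux\<close>.\<close>
    define G where "G = bary u v x p * bary u x v z - bary u x v p * bary u v x z"
    have zp: "0 < bary u v x z" "0 < bary u x v z" using zc \<tau> by simp_all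
    show False
    proof (cases "G \<ge> 0")
      case True
      have "bary u x v p < 0"
      proof (rule ccontr)
        assume "\<not> bary u x v p < 0"
        then have "bary u v x p * bary u x v z < 0" "bary u x v p * bary u v x z \<ge> 0"
          using neg zp by (auto simp: mult_less_0_iff)
        then show False using True by (simp add: G_def)
      qed
      then show False
        by (intro base_crossing_impossible[OF D vis(1) that(2) P(1) pu p'u that(3-5) zp])
          (use zc that True in \<open>auto simp: L_def G_def\<close>)
    next
      case False
      have "bary u v x p < 0"
      proof (rule ccontr)
        assume "\<not> bary u v x p < 0"
        then have "bary u x v p * bary u v x z < 0" "bary u v x p * bary u x v z \<ge> 0"
          using neg zp by (auto simp: mult_less_0_iff)
        then show False using False by (simp add: G_def)
      qed
      then show False
        by (intro base_crossing_impossible[OF D' vis(2) that(2) P(1) pu p'u that(3-5) zp(2,1)])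
          (use zc that False in \<open>auto simp: L_def G_def\<close>)
    qed
  qed
  have "L a < 1 \<or> L b < 1"
  proof (rule ccontr)
    assume "\<not> ?thesis"
    then have "L a > 1" "L b \<ge> 1" using La by auto
    then have "(1 - \<mu>) * L a > (1 - \<mu>) * 1" "\<mu> * L b \<ge> \<mu> * 1"
      using \<mu> by (auto intro!: mult_strict_left_mono mult_left_mono)
    then show False using L by simp
  qed
  then show False using key[OF _ ab \<mu>] key[OF _ ba \<mu>'] by blast
qed

text \<open>
  \<open>R a b l\<close> stands for a path from \<open>a\<close> to \<open>b\<close> of length at most \<open>l\<close>, and \<open>\<kappa>\<close> locates the point
  \<open>o = u + \<kappa> (w - u)\<close> such that all points of the triangle \<open>uvw\<close> other than \<open>u\<close> lie in the triangle \<open>vow\<close>. In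
  coordinates \<open>s, r\<close>, the next vertex \<open>x\<close> of the hull after \<open>v\<close> minimises \<open>r / (1 - s)\<close>, and this minimum is
  the value \<open>\<kappa>'\<close> at which the line \<open>vx\<close> meets \<open>uw\<close>.
\<close>

lemma convex_chain:
  fixes N :: "complex \<Rightarrow> real" and R :: "complex \<Rightarrow> complex \<Rightarrow> real \<Rightarrow> bool" and C :: real
  assumes N_tri: "\<And>a b. N (a + b) \<le> N a + N b" and N_scale: "\<And>t a. 0 \<le> t \<Longrightarrow> N (t *\<^sub>R a) = t * N a"
    and R_trans: "\<And>a b c l m. R a b l \<Longrightarrow> R b c m \<Longrightarrow> R a c (l + m)"
    and R_mono: "\<And>a b l m. R a b l \<Longrightarrow> l \<le> m \<Longrightarrow> R a b m"
    and C: "0 \<le> C" and uw: "u \<in> P" "w \<in> P" "sees S u w"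
    and "v \<in> P" "crs (v - u) (w - u) \<noteq> 0" "sees S u v"
    and "\<And>c. {u, c} \<in> S \<Longrightarrow> \<not> (0 < bary u v w c \<and> 0 < bary u w v c)"
    and "0 < \<kappa>" "\<kappa> \<le> 1"
    and "\<And>p. \<lbrakk>p \<in> P; p \<noteq> u; in_tri u v w p\<rbrakk> \<Longrightarrow> \<kappa> * (1 - bary u v w p) \<le> bary u w v p"
    and "\<And>p q. \<lbrakk>p \<in> P; q \<in> P; p \<noteq> u; q \<noteq> u; p \<noteq> q; in_tri u v w p; in_tri u v w q; sees S p q\<rbrakk>
        \<Longrightarrow> R p q (C * N (q - p))"
  shows "R v w (C * (N (\<kappa> *\<^sub>R (w - u) - (v - u)) + (1 - \<kappa>) * N (w - u)))"
  using assms(9-)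
proof (induction "card {p \<in> P. in_tri u v w p}" arbitrary: v \<kappa> rule: less_induct)
  case less
  note vP = less.prems(1) and D = less.prems(2) and vis = less.prems(3) and nocon = less.prems(4)
    and \<kappa> = less.prems(5,6) and above = less.prems(7) and step = less.prems(8)
  have D': "crs (w - u) (v - u) \<noteq> 0" using D crs_swap[of "w - u"] by simp
  have neq: "u \<noteq> v" "u \<noteq> w" "v \<noteq> w" using D by (auto simp: crs_def)
  have triv: "in_tri u v w v" "in_tri u v w w" using D D' by (auto simp: in_tri_def)
  define X where "X = {p \<in> P. in_tri u v w p \<and> p \<noteq> u \<and> p \<noteq> v}"
  define sl where "sl p = bary u w v p / (1 - bary u v w p)" for p
  have "finite X" "w \<in> X" using finite_P uw triv neq by (auto simp: X_def)
  then obtain x where x: "x \<in> X" "\<And>p. p \<in> X \<Longrightarrow> sl x \<le> sl p"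
    using arg_min_if_finite[of X sl] by (metis empty_iff leI)
  have s1: "bary u v w p < 1" if "p \<in> X" for p
  proof (rule ccontr)
    assume "\<not> ?thesis"
    then have "bary u v w p = 1" "bary u w v p = 0" using that by (auto simp: X_def in_tri_def)
    then have "p = v" using bary_decomp[OF D, of p] by simp
    then show False using that by (simp add: X_def)
  qed
  define s0 r0 where "s0 = bary u v w x" and "r0 = bary u w v x"
  have xP: "x \<in> P" "x \<noteq> u" "x \<noteq> v" "in_tri u v w x" using x(1) by (auto simp: X_def)
  have xd: "x - u = s0 *\<^sub>R (v - u) + r0 *\<^sub>R (w - u)"
    using bary_decomp[OF D, of x] by (simp add: s0_def r0_def algebra_simps)
  have s0: "0 \<le> s0" "s0 < 1" and r0': "0 \<le> r0" "s0 + r0 \<le> 1"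
    using xP(4) s1[OF x(1)] by (auto simp: s0_def r0_def in_tri_def)
  have r0: "0 < r0"
  proof (rule ccontr)
    assume "\<not> 0 < r0"
    then have "r0 = 0" using r0' by simp
    then have "crs (v - u) (x - u) = 0" using xd by (simp add: crs_def)
    then show False using crs_eq_0D[OF uw(1) vP xP(1)] neq xP by auto
  qed
  define \<kappa>' where "\<kappa>' = sl x"
  have \<kappa>'_r0: "r0 = \<kappa>' * (1 - s0)" using s0 by (simp add: \<kappa>'_def sl_def s0_def r0_def)
  have \<kappa>'_pos: "0 < \<kappa>'" "\<kappa>' \<le> 1"
    using s0 r0 r0' by (simp_all add: \<kappa>'_def sl_def s0_def[symmetric] r0_def[symmetric] field_simps)
  have \<kappa>'_ge: "\<kappa> \<le> \<kappa>'"
    using above[OF xP(1,2,4)] s0 by (simp add: \<kappa>'_def sl_def s0_def[symmetric] r0_def[symmetric] field_simps)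
  have above': "\<kappa>' * (1 - bary u v w p) \<le> bary u w v p"
    if "p \<in> P" "p \<noteq> u" "in_tri u v w p" for p
  proof (cases "p = v")
    case True
    then show ?thesis using D by simp
  next
    case False
    then have "p \<in> X" using that by (simp add: X_def)
    then show ?thesis using x(2)[OF \<open>p \<in> X\<close>] s1[OF \<open>p \<in> X\<close>]
      by (simp add: \<kappa>'_def[symmetric] sl_def[of p] field_simps)
  qed
  \<comment> \<open>The height \<open>s + r / \<kappa>'\<close> is 1 on the line \<open>vx\<close>
    and, by the choice of \<open>x\<close>, at least 1 at all points of the triangle except
    \<open>u\<close>.\<close>
  have ux: "sees S u x"
  proof (rule sees_lowest[where \<alpha> = 1 and \<beta> = "1 / \<kappa>'", OF uw(1) vP uw(2) xP(1) D vis uw(3) xP(2,4)])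
    show "1 * bary u v w x + 1 / \<kappa>' * bary u w v x \<le> 1"
      using \<kappa>'_r0 \<kappa>'_pos by (simp add: s0_def[symmetric] r0_def[symmetric])
    show "1 \<le> 1 * bary u v w p + 1 / \<kappa>' * bary u w v p" if "p \<in> P" "p \<noteq> u" "in_tri u v w p" for p
      using above'[OF that] \<kappa>'_pos by (simp add: field_simps)
  qed
  have Dvx: "crs (v - u) (x - u) \<noteq> 0"
    using crs_eq_0D[OF uw(1) vP xP(1)] neq xP by auto
  have coord: "bary u v w p = bary u v x p + bary u x v p * s0" "bary u w v p = bary u x v p * r0" for p
  proof -
    have "p = u + bary u v x p *\<^sub>R (v - u) + bary u x v p *\<^sub>R (x - u)" by (rule bary_decomp[OF Dvx])
    then have "p = u + (bary u v x p + bary u x v p * s0) *\<^sub>R (v - u) + (bary u x v p * r0) *\<^sub>R (w - u)"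
      unfolding xd by (simp add: algebra_simps)
    then show "bary u v w p = bary u v x p + bary u x v p * s0" "bary u w v p = bary u x v p * r0"
      by (rule bary_unique[OF D])+
  qed
  have vx: "sees S v x"
  proof (rule sees_base[OF uw(1) vP xP(1) Dvx vis ux])
    fix p assume p: "p \<in> P" "in_tri u v x p"
    define s r where "s = bary u v x p" and "r = bary u x v p"
    have sr: "0 \<le> s" "0 \<le> r" "s + r \<le> 1" using p(2) by (auto simp: in_tri_def s_def r_def)
    note c = coord[of p, folded s_def r_def]
    have "s + r * s0 + r * r0 = s + r * (s0 + r0)" by (simp add: algebra_simps)
    also have "\<dots> \<le> s + r * 1" using sr r0' by (intro add_left_mono mult_left_mono) auto
    finally have "in_tri u v w p" unfolding in_tri_def c using sr s0 r0' by auto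
    show "p = u \<or> p = v \<or> p = x"
    proof (cases "p = u")
      case False
      \<comment> \<open>In the coordinates of the triangle \<open>uvx\<close> the minimality of
        \<open>x\<close> reads \<open>1 \<le> s + r\<close>, so a point of that triangle other than
        \<open>u\<close> lies on \<open>vx\<close>.\<close>
      have "\<kappa>' * (1 - (s + r * s0)) \<le> r * (\<kappa>' * (1 - s0))"
        using above'[OF p(1) False \<open>in_tri u v w p\<close>] unfolding c \<kappa>'_r0[symmetric] .
      then have "\<kappa>' * (1 - (s + r * s0)) \<le> \<kappa>' * (r * (1 - s0))" by (simp add: algebra_simps)
      then have "1 - (s + r * s0) \<le> r * (1 - s0)" using \<kappa>'_pos by simp
      then have "1 \<le> s + r" by (simp add: algebra_simps)
      then have s: "s = 1 - r" using sr by simp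
      have "p = u + s *\<^sub>R (v - u) + r *\<^sub>R (x - u)" unfolding s_def r_def by (rule bary_decomp[OF Dvx])
      then have "p - v = r *\<^sub>R (x - v)" unfolding s by (simp add: algebra_simps)
      then have "crs (p - v) (x - v) = 0" by (simp add: crs_def)
      then show ?thesis using crs_eq_0D[OF vP p(1) xP(1)] xP by auto
    qed simp
  next
    fix c assume c: "{u, c} \<in> S"
    show "\<not> (0 < bary u v x c \<and> 0 < bary u x v c)"
    proof
      assume "0 < bary u v x c \<and> 0 < bary u x v c"
      then have "0 < bary u v w c" "0 < bary u w v c" unfolding coord using s0 r0
        by (auto intro!: add_pos_nonneg)
      then show False using nocon[OF c] by simp
    qed
  qed
  \<comment> \<open>Sliding \<open>o\<close> along \<open>uw\<close> from \<kappa> to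
    \<open>\<kappa>'\<close> does not lengthen the path \<open>v, o, w\<close>, by the triangle
    inequality.\<close>
  have N_vo: "N (\<kappa>' *\<^sub>R (w - u) - (v - u)) + (1 - \<kappa>') * N (w - u)
      \<le> N (\<kappa> *\<^sub>R (w - u) - (v - u)) + (1 - \<kappa>) * N (w - u)"
  proof -
    have eq: "\<kappa>' *\<^sub>R (w - u) - (v - u) = (\<kappa> *\<^sub>R (w - u) - (v - u)) + (\<kappa>' - \<kappa>) *\<^sub>R (w - u)"
      by (simp add: algebra_simps)
    have "N (\<kappa>' *\<^sub>R (w - u) - (v - u)) \<le> N (\<kappa> *\<^sub>R (w - u) - (v - u)) + N ((\<kappa>' - \<kappa>) *\<^sub>R (w - u))"
      unfolding eq by (rule N_tri)
    also have "N ((\<kappa>' - \<kappa>) *\<^sub>R (w - u)) = (\<kappa>' - \<kappa>) * N (w - u)" using N_scale \<kappa>'_ge by simp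
    finally have "N (\<kappa>' *\<^sub>R (w - u) - (v - u)) \<le> N (\<kappa> *\<^sub>R (w - u) - (v - u)) + (\<kappa>' - \<kappa>) * N (w - u)" .
    then show ?thesis by (simp add: algebra_simps)
  qed
  have xv: "x - v = (1 - s0) *\<^sub>R (\<kappa>' *\<^sub>R (w - u) - (v - u))"
  proof -
    have "x - v = (x - u) - (v - u)" by simp
    also have "\<dots> = (1 - s0) *\<^sub>R (\<kappa>' *\<^sub>R (w - u) - (v - u))"
      unfolding xd \<kappa>'_r0 by (simp add: algebra_simps)
    finally show ?thesis .
  qed
  have Rvx: "R v x (C * N (x - v))"
    by (rule step[OF vP xP(1) neq(1)[symmetric] xP(2) xP(3)[symmetric] triv(1) xP(4) vx])
  have Nxv: "N (x - v) = (1 - s0) * N (\<kappa>' *\<^sub>R (w - u) - (v - u))"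
    unfolding xv using N_scale s0 by simp
  show ?case
  proof (cases "x = w")
    case True
    then have "s0 = 0" "r0 = 1" using D D' by (auto simp: s0_def r0_def)
    then have "\<kappa>' = 1" using \<kappa>'_r0 by simp
    then have "N (x - v) \<le> N (\<kappa> *\<^sub>R (w - u) - (v - u)) + (1 - \<kappa>) * N (w - u)"
      using Nxv N_vo \<open>s0 = 0\<close> by simp
    then have "C * N (x - v) \<le> C * (N (\<kappa> *\<^sub>R (w - u) - (v - u)) + (1 - \<kappa>) * N (w - u))"
      using C by (rule mult_left_mono)
    then show ?thesis using R_mono[OF Rvx] True by simp
  next
    case False
    have Dxw: "crs (x - u) (w - u) \<noteq> 0"
      using crs_eq_0D[OF uw(1) xP(1) uw(2)] neq xP False by auto
    then have "s0 \<noteq> 0" using xd by (auto simp: crs_def)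
    then have s0p: "0 < s0" using s0 by simp
    have crd: "bary u v w p = bary u x w p * s0" "bary u w v p = bary u w x p + bary u x w p * r0" for p
    proof -
      have "p = u + bary u x w p *\<^sub>R (x - u) + bary u w x p *\<^sub>R (w - u)" by (rule bary_decomp[OF Dxw])
      then have "p = u + (bary u x w p * s0) *\<^sub>R (v - u) + (bary u w x p + bary u x w p * r0) *\<^sub>R (w - u)"
        unfolding xd by (simp add: algebra_simps)
      then show "bary u v w p = bary u x w p * s0" "bary u w v p = bary u w x p + bary u x w p * r0"
        by (rule bary_unique[OF D])+
    qed
    have sub: "in_tri u v w p" if "in_tri u x w p" for p
    proof -
      define s r where "s = bary u x w p" and "r = bary u w x p"
      have sr: "0 \<le> s" "0 \<le> r" "s + r \<le> 1" using that by (auto simp: in_tri_def s_def r_def)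
      have "s * s0 + (r + s * r0) = r + s * (s0 + r0)" by (simp add: algebra_simps)
      also have "\<dots> \<le> r + s * 1" using sr r0' by (intro add_left_mono mult_left_mono) auto
      finally show ?thesis unfolding in_tri_def crd s_def[symmetric] r_def[symmetric]
        using sr s0 r0' by auto
    qed
    \<comment> \<open>The coordinate of \<open>v\<close> along \<open>x - u\<close> would be
      \<open>1 / s0 > 1\<close>.\<close>
    have nv: "\<not> in_tri u x w v"
    proof
      assume t: "in_tri u x w v"
      then have "bary u x w v * s0 = 1" "bary u x w v \<le> 1" using crd(1)[of v] D by (auto simp: in_tri_def)
      then show False using s0 mult_right_mono[of "bary u x w v" 1 s0] by simp
    qed
    have smaller: "card {p \<in> P. in_tri u x w p} < card {p \<in> P. in_tri u v w p}"
    proof (rule psubset_card_mono)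
      show "finite {p \<in> P. in_tri u v w p}" using finite_P by simp
      show "{p \<in> P. in_tri u x w p} \<subset> {p \<in> P. in_tri u v w p}" using sub nv vP triv(1) by blast
    qed
    \<comment> \<open>The line \<open>vx\<close> meets \<open>uw\<close> at
      \<open>\<kappa>'\<close>, so the lower bound passes to the triangle \<open>uxw\<close> with
      the same \<open>\<kappa>'\<close>; the loss of \<open>v\<close> decreases the count.\<close>
    have Rxw: "R x w (C * (N (\<kappa>' *\<^sub>R (w - u) - (x - u)) + (1 - \<kappa>') * N (w - u)))"
    proof (rule less.hyps[OF smaller xP(1) Dxw ux _ \<kappa>'_pos])
      fix c assume c: "{u, c} \<in> S"
      show "\<not> (0 < bary u x w c \<and> 0 < bary u w x c)"
      proof
        assume "0 < bary u x w c \<and> 0 < bary u w x c"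
        then have "0 < bary u v w c" "0 < bary u w v c" unfolding crd using s0p r0
          by (auto intro!: add_pos_nonneg)
        then show False using nocon[OF c] by simp
      qed
    next
      fix p assume p: "p \<in> P" "p \<noteq> u" "in_tri u x w p"
      have "\<kappa>' * (1 - bary u x w p * s0) \<le> bary u w x p + bary u x w p * (\<kappa>' * (1 - s0))"
        using above'[OF p(1,2) sub[OF p(3)]] unfolding crd \<kappa>'_r0[symmetric] .
      then show "\<kappa>' * (1 - bary u x w p) \<le> bary u w x p" by (simp add: algebra_simps)
    next
      fix p q assume "p \<in> P" "q \<in> P" "p \<noteq> u" "q \<noteq> u" "p \<noteq> q" "in_tri u x w p" "in_tri u x w q" "sees S p q"
      then show "R p q (C * N (q - p))" using step sub by blast
    qed
    \<comment> \<open>\<open>x\<close> cuts the segment from \<open>v\<close> to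
      \<open>u + \<kappa>' (w - u)\<close> into fractions \<open>1 - s0\<close> and
      \<open>s0\<close>, so the two lengths add up exactly.\<close>
    have "\<kappa>' *\<^sub>R (w - u) - (x - u) = s0 *\<^sub>R (\<kappa>' *\<^sub>R (w - u) - (v - u))"
      unfolding xd \<kappa>'_r0 by (simp add: algebra_simps)
    then have "N (\<kappa>' *\<^sub>R (w - u) - (x - u)) = s0 * N (\<kappa>' *\<^sub>R (w - u) - (v - u))"
      using N_scale s0 by simp
    then have "C * N (x - v) + C * (N (\<kappa>' *\<^sub>R (w - u) - (x - u)) + (1 - \<kappa>') * N (w - u))
      = C * (N (\<kappa>' *\<^sub>R (w - u) - (v - u)) + (1 - \<kappa>') * N (w - u))"
      unfolding Nxv by (simp add: algebra_simps)
    also have "\<dots> \<le> C * (N (\<kappa> *\<^sub>R (w - u) - (v - u)) + (1 - \<kappa>) * N (w - u))"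
      using N_vo C by (rule mult_left_mono)
    finally show ?thesis using R_mono[OF R_trans[OF Rvx Rxw]] by blast
  qed
qed

end

subsection \<open>Paths, cones and rotated L1 norms\<close>

definition reach :: "nat \<Rightarrow> complex set \<Rightarrow> complex set set \<Rightarrow> complex \<Rightarrow> complex \<Rightarrow> real \<Rightarrow> bool" where
  "reach n P S u w L \<longleftrightarrow> (\<exists>xs. is_path n P S xs u w \<and> path_length xs \<le> L)"

lemma path_length_Cons: "path_length (x # y # zs) = dist x y + path_length (y # zs)"
  by (simp add: path_length_def sum.lessThan_Suc_shift del: sum.lessThan_Suc)

lemma is_path_Cons:
  "is_path n P S (x # y # zs) u w \<longleftrightarrow> x = u \<and> theta_edge n P S x y \<and> is_path n P S (y # zs) y w"
proof -
  have "(\<forall>j. Suc j < length (x # y # zs) \<longrightarrow> theta_edge n P S ((x # y # zs) ! j) ((x # y # zs) ! Suc j))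
    \<longleftrightarrow> theta_edge n P S x y \<and>
      (\<forall>j. Suc j < length (y # zs) \<longrightarrow> theta_edge n P S ((y # zs) ! j) ((y # zs) ! Suc j))" (is "?L \<longleftrightarrow> ?R")
  proof
    assume L: ?L
    show ?R
    proof (intro conjI allI impI)
      show "theta_edge n P S x y" using L[rule_format, of 0] by simp
      fix j assume "Suc j < length (y # zs)"
      then show "theta_edge n P S ((y # zs) ! j) ((y # zs) ! Suc j)" using L[rule_format, of "Suc j"] by simp
    qed
  next
    assume R: ?R
    show ?L
    proof (intro allI impI)
      fix j assume "Suc j < length (x # y # zs)"
      then show "theta_edge n P S ((x # y # zs) ! j) ((x # y # zs) ! Suc j)" using R by (cases j) auto
    qed
  qed
  then show ?thesis unfolding is_path_def by auto
qed

text \<open>\<open>tl ys\<close> drops the second copy of the shared vertex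
  \<open>v\<close>.\<close>

lemma is_path_append:
  assumes "is_path n P S xs u v" "is_path n P S ys v w"
  shows "is_path n P S (xs @ tl ys) u w \<and> path_length (xs @ tl ys) = path_length xs + path_length ys"
  using assms
proof (induction xs arbitrary: u rule: induct_list012)
  case 1
  then show ?case by (simp add: is_path_def)
next
  case (2 x)
  then have "x = v" "x = u" "ys \<noteq> []" "hd ys = v" by (auto simp: is_path_def)
  then have "[x] @ tl ys = ys" by (cases ys) auto
  then show ?case using 2 \<open>x = v\<close> \<open>x = u\<close> by (auto simp: path_length_def[of "[v]"])
next
  case (3 x y zs)
  then show ?case by (auto simp: is_path_Cons path_length_Cons)
qed

lemma reach_trans:
  assumes "reach n P S u v l" "reach n P S v w m"
  shows "reach n P S u w (l + m)"
proof -
  obtain xs ys where "is_path n P S xs u v" "path_length xs \<le> l" "is_path n P S ys v w" "path_length ys \<le> m"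
    using assms unfolding reach_def by blast
  then have "is_path n P S (xs @ tl ys) u w" "path_length (xs @ tl ys) \<le> l + m"
    using is_path_append[of n P S xs u v ys w] by simp_all
  then show ?thesis unfolding reach_def by blast
qed

lemma reach_mono: "reach n P S u v l \<Longrightarrow> l \<le> m \<Longrightarrow> reach n P S u v m"
  unfolding reach_def using order_trans by blast

lemma reach_edge:
  assumes "theta_edge n P S u v"
  shows "reach n P S u v (dist u v)"
proof -
  have "is_path n P S [u, v] u v" using assms unfolding is_path_Cons by (simp add: is_path_def)
  moreover have "path_length [u, v] \<le> dist u v" by (simp add: path_length_def)
  ultimately show ?thesis unfolding reach_def by blast
qed

text \<open>For a unit vector \<open>b\<close>, multiplying by \<open>cnj b\<close> rotates
  \<open>b\<close> onto the real axis; this is the L1 norm in the orthonormal frame with first axis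
  \<open>b\<close>.\<close>

definition l1 :: "complex \<Rightarrow> complex \<Rightarrow> real" where
  "l1 b p = \<bar>Re (p * cnj b)\<bar> + \<bar>Im (p * cnj b)\<bar>"

lemma l1_triangle: "l1 b (p + q) \<le> l1 b p + l1 b q"
proof -
  have eq: "(p + q) * cnj b = p * cnj b + q * cnj b" by (simp add: distrib_right)
  show ?thesis unfolding l1_def eq plus_complex.sel
    using abs_triangle_ineq[of "Re (p * cnj b)" "Re (q * cnj b)"]
      abs_triangle_ineq[of "Im (p * cnj b)" "Im (q * cnj b)"] by linarith
qed

lemma l1_scale: "0 \<le> t \<Longrightarrow> l1 b (t *\<^sub>R p) = t * l1 b p"
  unfolding l1_def mult_scaleR_left scaleR_complex.sel abs_mult by (simp add: distrib_left)

lemma l1_cis: "0 \<le> r \<Longrightarrow> l1 (cis b) (complex_of_real r * cis p) = r * (\<bar>cos (p - b)\<bar> + \<bar>sin (p - b)\<bar>)"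
proof -
  assume r: "0 \<le> r"
  have eq: "complex_of_real r * cis p * cnj (cis b) = complex_of_real r * cis (p - b)"
    by (simp add: cis_cnj cis_mult mult.assoc)
  show ?thesis unfolding l1_def eq using r by (simp add: abs_mult distrib_left)
qed

text \<open>Since the absolute sine has period \<pi>, \<open>m\<close> can be reduced modulo
  \<open>K\<close>. A nonzero remainder moves \<open>e\<close> into the interval from
  \<open>\<bar>e\<bar>\<close> to \<open>pi - \<bar>e\<bar>\<close>, where the sine is at least
  \<open>sin \<bar>e\<bar>\<close>.\<close>

lemma abs_sin_le_shifted:
  fixes m :: int and K :: nat
  assumes K: "0 < K" and e: "\<bar>e\<bar> \<le> pi / (2 * K)"
  shows "\<bar>sin e\<bar> \<le> \<bar>sin (e + m * (pi / K))\<bar>"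
proof -
  define q r where "q = m div int K" and "r = m mod int K"
  have m: "m = q * int K + r" by (simp add: q_def r_def)
  have r: "0 \<le> r" "r < int K" using K by (simp_all add: r_def)
  define y where "y = e + r * (pi / K)"
  have "e + m * (pi / K) = y + q * pi" using K unfolding m y_def by (simp add: field_simps)
  moreover have s0: "sin (real_of_int q * pi) = 0" unfolding sin_zero_iff_int2 by blast
  moreover have "\<bar>cos (real_of_int q * pi)\<bar> = 1"
    using sin_cos_squared_add[of "real_of_int q * pi"] s0 by (auto simp: power2_eq_1_iff)
  ultimately have "\<bar>sin (e + m * (pi / K))\<bar> = \<bar>sin y\<bar>"
    by (simp add: sin_add abs_mult)
  moreover have "\<bar>sin e\<bar> \<le> \<bar>sin y\<bar>"
  proof (cases "r = 0")
    case True
    then show ?thesis by (simp add: y_def)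
  next
    case False
    have rr: "1 \<le> real_of_int r" "real_of_int r \<le> real K - 1" using r False by linarith+
    have "pi / K = 2 * (pi / (2 * K))" by simp
    then have e2: "2 * \<bar>e\<bar> \<le> pi / K" using e by linarith
    have "1 * (pi / K) \<le> r * (pi / K)" "r * (pi / K) \<le> (real K - 1) * (pi / K)"
      using rr by (intro mult_right_mono; simp)+
    moreover have "(real K - 1) * (pi / K) = pi - pi / K" using K by (simp add: field_simps)
    ultimately have y: "\<bar>e\<bar> \<le> y" "y \<le> pi - \<bar>e\<bar>" unfolding y_def using e2 by linarith+
    have epi: "\<bar>e\<bar> \<le> pi / 2" using y by linarith
    have "0 \<le> sin \<bar>e\<bar>" using epi by (intro sin_ge_zero) auto
    moreover have "\<bar>sin e\<bar> = \<bar>sin \<bar>e\<bar>\<bar>" by (cases "0 \<le> e") simp_all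
    ultimately have "\<bar>sin e\<bar> = sin \<bar>e\<bar>" by simp
    also have "\<dots> \<le> sin y"
    proof (cases "y \<le> pi / 2")
      case True
      then show ?thesis using y epi by (intro sin_monotone_2pi_le) auto
    next
      case False
      then have "sin \<bar>e\<bar> \<le> sin (pi - y)" using y epi by (intro sin_monotone_2pi_le) auto
      then show ?thesis by simp
    qed
    finally show ?thesis by simp
  qed
  ultimately show ?thesis by simp
qed

lemma in_cone_frame:
  assumes "in_cone n u i v"
  obtains d where "- (cone_angle n / 2) \<le> d" "d \<le> cone_angle n / 2"
    "v - u = complex_of_real (cmod (v - u)) * cis (pi / 2 - real i * cone_angle n + d)"
    "(v - u) * cnj (bisector n i) = complex_of_real (cmod (v - u)) * cis d"
proof -
  obtain \<phi> where \<phi>: "cone_lo n i \<le> \<phi>" "\<phi> < cone_lo n i + cone_angle n"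
    "v - u = complex_of_real (cmod (v - u)) * cis \<phi>"
    using assms unfolding in_cone_def by blast
  define d where "d = \<phi> - (pi / 2 - real i * cone_angle n)"
  have v: "v - u = complex_of_real (cmod (v - u)) * cis (pi / 2 - real i * cone_angle n + d)"
    using \<phi>(3) by (simp add: d_def)
  show thesis
  proof (rule that[of d])
    show "- (cone_angle n / 2) \<le> d" "d \<le> cone_angle n / 2" using \<phi>(1,2) by (simp_all add: d_def cone_lo_def)
    show "v - u = complex_of_real (cmod (v - u)) * cis (pi / 2 - real i * cone_angle n + d)" by (rule v)
    show "(v - u) * cnj (bisector n i) = complex_of_real (cmod (v - u)) * cis d"
      by (subst v) (simp add: bisector_def cis_cnj cis_mult mult.assoc)
  qed
qed

text \<open>Squaring turns the L1 norm of a unit vector into a function of the doubled angle, so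
  comparing frames becomes comparing sines.\<close>

lemma sq_abs_cos_sin: "(\<bar>cos x\<bar> + \<bar>sin x\<bar>)\<^sup>2 = 1 + \<bar>sin (2 * x :: real)\<bar>"
proof -
  have "(\<bar>cos x\<bar> + \<bar>sin x\<bar>)\<^sup>2 = (cos x)\<^sup>2 + (sin x)\<^sup>2 + 2 * (\<bar>sin x\<bar> * \<bar>cos x\<bar>)"
    by (simp add: power2_sum)
  then show ?thesis by (simp add: sin_double abs_mult)
qed

text \<open>With \<open>4 * k + 4\<close> cones, doubled angles to different bisectors differ by
  multiples of \<open>pi / (k + 1)\<close>, a divisor of the period \<pi>, and the doubled angle to
  the own bisector is at most half of that.\<close>

lemma l1_own_bisector_le:
  assumes "in_cone n v j x" and n: "n = 4 * k + 4"
  shows "l1 (bisector n j) (x - v) \<le> l1 (bisector n i) (x - v)"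
proof -
  define r where "r = cmod (x - v)"
  obtain d where d: "- (cone_angle n / 2) \<le> d" "d \<le> cone_angle n / 2"
    "x - v = complex_of_real r * cis (pi / 2 - real j * cone_angle n + d)"
    using in_cone_frame[OF assms(1)] unfolding r_def by metis
  define e where "e = pi / 2 - real j * cone_angle n + d - (pi / 2 - real i * cone_angle n)"
  have r: "0 \<le> r" by (simp add: r_def)
  have lj: "l1 (bisector n j) (x - v) = r * (\<bar>cos d\<bar> + \<bar>sin d\<bar>)"
    unfolding bisector_def d(3) l1_cis[OF r] by simp
  have li: "l1 (bisector n i) (x - v) = r * (\<bar>cos e\<bar> + \<bar>sin e\<bar>)"
    unfolding bisector_def d(3) l1_cis[OF r] e_def by simp
  have ca: "cone_angle n = pi / (2 * real (k + 1))" unfolding cone_angle_def n by (simp add: field_simps)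
  have ca2: "2 * cone_angle n = pi / real (k + 1)" unfolding ca by (simp add: field_simps)
  have "2 * e = 2 * d + (int i - int j) * (pi / real (k + 1))"
    unfolding e_def ca2[symmetric] by (simp add: algebra_simps)
  moreover have "\<bar>2 * d\<bar> \<le> pi / (2 * real (k + 1))" using d(1,2) unfolding ca[symmetric] by linarith
  ultimately have "\<bar>sin (2 * d)\<bar> \<le> \<bar>sin (2 * e)\<bar>"
    using abs_sin_le_shifted[of "k + 1" "2 * d" "int i - int j"] by simp
  then have "(\<bar>cos d\<bar> + \<bar>sin d\<bar>)\<^sup>2 \<le> (\<bar>cos e\<bar> + \<bar>sin e\<bar>)\<^sup>2" unfolding sq_abs_cos_sin by simp
  then have "\<bar>cos d\<bar> + \<bar>sin d\<bar> \<le> \<bar>cos e\<bar> + \<bar>sin e\<bar>" by (rule power2_le_imp_le) simp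
  then show ?thesis unfolding li lj using r by (rule mult_left_mono)
qed

section \<open>Directions, sectors and subcones\<close>

lemma in_cone_exists:
  assumes "0 < n" "v \<noteq> u"
  shows "\<exists>i. in_cone n u i v"
proof -
  define c where "c = cone_angle n"
  define \<phi> where "\<phi> = Arg (v - u)"
  have c: "0 < c" "real n * c = 2 * pi" using assms(1) by (simp_all add: c_def cone_angle_def)
  \<comment> \<open>The real index at which the lower boundary of the cone would have angle \<phi>.
    Rounding up respects the half-open range, and reducing modulo \<open>n\<close> costs
    \<open>q\<close> full turns.\<close>
  define y where "y = (pi / 2 - c / 2 - \<phi>) / c"
  define I where "I = \<lceil>y\<rceil>"
  define i where "i = nat (I mod int n)"
  define q where "q = I div int n"
  have i: "i < n" "int i = I mod int n" using assms(1) by (simp_all add: i_def nat_less_iff)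
  have I: "real_of_int I = real_of_int q * real n + real i"
  proof -
    have "I = q * int n + int i" by (simp add: q_def i(2))
    then show ?thesis by (metis of_int_add of_int_mult of_int_of_nat_eq)
  qed
  have "y \<le> I" "I < y + 1" unfolding I_def by linarith+
  then have "y * c \<le> I * c" "I * c < (y + 1) * c" using c(1) by simp_all
  moreover have "y * c = pi / 2 - c / 2 - \<phi>" using c(1) by (simp add: y_def)
  moreover have "I * c = 2 * pi * q + i * c"
    unfolding I using c(2) by (simp add: algebra_simps)
  ultimately have "cone_lo n i \<le> \<phi> + 2 * pi * q" "\<phi> + 2 * pi * q < cone_lo n i + cone_angle n"
    unfolding cone_lo_def c_def[symmetric] by (simp_all add: algebra_simps)
  moreover have "v - u = complex_of_real (cmod (v - u)) * cis (\<phi> + 2 * pi * q)"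
  proof -
    have "cis (2 * pi * real_of_int q) = 1" by (rule cis_multiple_2pi) simp
    then have "cis (\<phi> + 2 * pi * q) = cis \<phi>" by (simp add: cis_mult[symmetric])
    then show ?thesis using Arg_eq[of "v - u"] assms(2) rcis_cmod_Arg[of "v - u"]
      by (simp add: \<phi>_def rcis_def)
  qed
  ultimately show ?thesis unfolding in_cone_def using i(1) assms(2) by blast
qed

lemma cis_inj_small:
  assumes "cis x = cis y" "\<bar>x - y\<bar> < 2 * pi"
  shows "x = y"
proof -
  have "cis (x - y) = 1" using assms(1) by (simp add: cis_divide[symmetric])
  then have "cos (x - y) = 1" by (simp add: complex_eq_iff)
  then obtain m :: int where m: "x - y = real_of_int m * 2 * pi" unfolding cos_one_2pi_int by blast
  then have "\<bar>real_of_int m\<bar> * (2 * pi) < 1 * (2 * pi)" using assms(2) by (simp add: abs_mult)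
  then have "\<bar>real_of_int m\<bar> < 1" by (rule mult_right_less_imp_less) simp
  then have "m = 0" by linarith
  then show ?thesis using m by simp
qed

text \<open>The half-open range is at most one turn long, so the described angle is unique.\<close>

lemma dir_in_cone_eqI:
  assumes "2 \<le> n" "v \<noteq> u" "cone_lo n i \<le> \<phi>" "\<phi> < cone_lo n i + cone_angle n"
    "v - u = complex_of_real (cmod (v - u)) * cis \<phi>"
  shows "dir_in_cone n u i v = \<phi>"
  unfolding dir_in_cone_def
proof (rule the_equality)
  show "cone_lo n i \<le> \<phi> \<and> \<phi> < cone_lo n i + cone_angle n \<and> v - u = complex_of_real (cmod (v - u)) * cis \<phi>"
    using assms by blast
  fix \<psi> assume \<psi>: "cone_lo n i \<le> \<psi> \<and> \<psi> < cone_lo n i + cone_angle n \<and> v - u = complex_of_real (cmod (v - u)) * cis \<psi>"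
  have "cone_angle n \<le> 2 * pi" using assms(1) by (simp add: cone_angle_def field_simps)
  then have "\<bar>\<psi> - \<phi>\<bar> < 2 * pi" using \<psi> assms(3,4) by linarith
  moreover have "complex_of_real (cmod (v - u)) * cis \<psi> = complex_of_real (cmod (v - u)) * cis \<phi>"
    using \<psi> assms(5) by metis
  then have "cis \<psi> = cis \<phi>" using assms(2) by simp
  ultimately show "\<psi> = \<phi>" using cis_inj_small by blast
qed

lemma dir_in_cone:
  assumes "2 \<le> n" "in_cone n u i v"
  shows "cone_lo n i \<le> dir_in_cone n u i v" "dir_in_cone n u i v < cone_lo n i + cone_angle n"
    "v - u = complex_of_real (cmod (v - u)) * cis (dir_in_cone n u i v)"
proof -
  obtain \<phi> where \<phi>: "v \<noteq> u" "cone_lo n i \<le> \<phi>" "\<phi> < cone_lo n i + cone_angle n"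
    "v - u = complex_of_real (cmod (v - u)) * cis \<phi>"
    using assms(2) unfolding in_cone_def by blast
  with dir_in_cone_eqI[OF assms(1) \<phi>]
  show "cone_lo n i \<le> dir_in_cone n u i v" "dir_in_cone n u i v < cone_lo n i + cone_angle n"
    "v - u = complex_of_real (cmod (v - u)) * cis (dir_in_cone n u i v)" by simp_all
qed

text \<open>Rotate by \<open>- a\<close>, so that the sector starts at the positive real axis: the
  sign of the imaginary part gives the lower bound on the angle, and its sign after a further turn
  by \<open>- \<delta>\<close> the upper one.\<close>

lemma cis_combination_between:
  assumes "a \<le> b" "b - a < pi / 2" "0 \<le> s" "0 \<le> r" "0 < s + r"
    and p: "p = complex_of_real s * cis a + complex_of_real r * cis b"
  obtains \<phi> where "a \<le> \<phi>" "\<phi> \<le> b" "p = complex_of_real (cmod p) * cis \<phi>"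
    "0 < s \<Longrightarrow> 0 < r \<Longrightarrow> a < b \<Longrightarrow> a < \<phi> \<and> \<phi> < b"
proof -
  define \<delta> where "\<delta> = b - a"
  have \<delta>: "0 \<le> \<delta>" "\<delta> < pi / 2" using assms by (simp_all add: \<delta>_def)
  have cos: "0 < cos \<delta>" and sin: "0 \<le> sin \<delta>" using \<delta> by (auto intro!: cos_gt_zero_pi sin_ge_zero)
  define z where "z = p * cis (- a)"
  have "z = complex_of_real s * (cis a * cis (- a)) + complex_of_real r * (cis b * cis (- a))"
    unfolding z_def p by (simp add: algebra_simps)
  then have z: "z = complex_of_real s + complex_of_real r * cis \<delta>"
    unfolding cis_mult by (simp add: \<delta>_def)
  have pz: "p = z * cis a" by (simp add: z_def mult.assoc cis_mult)
  have Rez: "0 < Re z"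
  proof (cases "s = 0")
    case True
    then show ?thesis using assms(5) cos by (simp add: z)
  next
    case False
    then show ?thesis using assms(3,4) cos by (simp add: z add_pos_nonneg)
  qed
  have Imz: "Im z = r * sin \<delta>" by (simp add: z)
  define \<psi> where "\<psi> = Arg z"
  have zpsi: "z = complex_of_real (cmod z) * cis \<psi>"
    using rcis_cmod_Arg[of z] by (simp add: \<psi>_def rcis_def)
  have z0: "0 < cmod z" using Rez by auto
  have "0 \<le> Im z" using Imz assms(4) sin by simp
  then have psi0: "0 \<le> \<psi>" by (simp add: \<psi>_def Arg_less_0)
  have psi1: "\<psi> < pi / 2" using Rez Arg_Re_pos[of z] by (simp add: \<psi>_def abs_less_iff)
  have Im2: "cmod z * sin (\<psi> - \<delta>) = - (s * sin \<delta>)"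
  proof -
    have "z * cis (- \<delta>) = complex_of_real (cmod z) * cis (\<psi> - \<delta>)"
      by (subst zpsi) (simp add: mult.assoc cis_mult)
    moreover have "z * cis (- \<delta>) = complex_of_real s * cis (- \<delta>) + complex_of_real r"
      unfolding z by (simp add: algebra_simps cis_mult)
    ultimately have "Im (complex_of_real (cmod z) * cis (\<psi> - \<delta>)) = Im (complex_of_real s * cis (- \<delta>) + complex_of_real r)"
      by simp
    then show ?thesis by simp
  qed
  have le: "\<psi> \<le> \<delta>"
  proof (rule ccontr)
    assume "\<not> \<psi> \<le> \<delta>"
    then have "0 < sin (\<psi> - \<delta>)" using psi1 \<delta> by (intro sin_gt_zero) auto
    then have "0 < cmod z * sin (\<psi> - \<delta>)" using z0 by simp
    then show False using Im2 mult_nonneg_nonneg[OF assms(3) sin] by simp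
  qed
  show thesis
  proof (rule that[of "a + \<psi>"])
    show "a \<le> a + \<psi>" "a + \<psi> \<le> b" using psi0 le by (simp_all add: \<delta>_def)
    have "cmod p = cmod z" by (simp add: pz norm_mult)
    then show "p = complex_of_real (cmod p) * cis (a + \<psi>)"
      by (metis pz zpsi cis_mult mult.assoc mult.commute)
    assume sr: "0 < s" "0 < r" "a < b"
    then have "0 < sin \<delta>" using \<delta> by (intro sin_gt_zero) (auto simp: \<delta>_def)
    then have "0 < Im z" "cmod z * sin (\<psi> - \<delta>) < 0" using Imz Im2 sr by simp_all
    moreover have "Im z = cmod z * sin \<psi>" using arg_cong[OF zpsi, of Im] by simp
    ultimately have "\<psi> \<noteq> 0" "\<psi> \<noteq> \<delta>" by auto
    then show "a < a + \<psi> \<and> a + \<psi> < b" using psi0 le by (auto simp: \<delta>_def)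
  qed
qed

text \<open>The triangle spanned by two points of a subcone stays in it. Strictness for positive
  coefficients shows that a constraint into the open angle would split the subcone.\<close>

lemma in_cone_combination:
  assumes n: "5 \<le> n" and v: "in_cone n u i v" and w: "in_cone n u i w"
    and sr: "0 \<le> s" "0 \<le> r" and p: "p - u = s *\<^sub>R (v - u) + r *\<^sub>R (w - u)" "p \<noteq> u"
  defines "dv \<equiv> dir_in_cone n u i v" and "dw \<equiv> dir_in_cone n u i w"
  shows "in_cone n u i p" "min dv dw \<le> dir_in_cone n u i p" "dir_in_cone n u i p \<le> max dv dw"
    "0 < s \<Longrightarrow> 0 < r \<Longrightarrow> dv \<noteq> dw \<Longrightarrow> min dv dw < dir_in_cone n u i p \<and> dir_in_cone n u i p < max dv dw"
proof -
  have n2: "2 \<le> n" using n by simp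
  note dv = dir_in_cone[OF n2 v, folded dv_def] and dw = dir_in_cone[OF n2 w, folded dw_def]
  have ca: "cone_angle n < pi / 2" using n by (simp add: cone_angle_def field_simps)
  define s' r' where "s' = s * cmod (v - u)" and "r' = r * cmod (w - u)"
  have vw: "v \<noteq> u" "w \<noteq> u" using v w by (auto simp: in_cone_def)
  have sr': "0 \<le> s'" "0 \<le> r'" using sr by (simp_all add: s'_def r'_def)
  have "s \<noteq> 0 \<or> r \<noteq> 0" using p by auto
  then have "s' \<noteq> 0 \<or> r' \<noteq> 0" using vw by (simp add: s'_def r'_def)
  then have sum: "0 < s' + r'" "0 < r' + s'" using sr' by linarith+
  have "s *\<^sub>R (v - u) = complex_of_real s' * cis dv" "r *\<^sub>R (w - u) = complex_of_real r' * cis dw"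
    by (subst dv(3) dw(3), simp add: s'_def r'_def scaleR_conv_of_real)+
  then have pc: "p - u = complex_of_real s' * cis dv + complex_of_real r' * cis dw"
    "p - u = complex_of_real r' * cis dw + complex_of_real s' * cis dv"
    unfolding p(1) by simp_all
  obtain \<phi> where \<phi>: "min dv dw \<le> \<phi>" "\<phi> \<le> max dv dw" "p - u = complex_of_real (cmod (p - u)) * cis \<phi>"
    "0 < s \<Longrightarrow> 0 < r \<Longrightarrow> dv \<noteq> dw \<Longrightarrow> min dv dw < \<phi> \<and> \<phi> < max dv dw"
  proof (cases "dv \<le> dw")
    case True
    have "dw - dv < pi / 2" using dv dw ca by linarith
    from cis_combination_between[OF True this sr' sum(1) pc(1)]
    obtain \<phi> where \<phi>: "dv \<le> \<phi>" "\<phi> \<le> dw" "p - u = complex_of_real (cmod (p - u)) * cis \<phi>"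
      "0 < s' \<Longrightarrow> 0 < r' \<Longrightarrow> dv < dw \<Longrightarrow> dv < \<phi> \<and> \<phi> < dw" by metis
    show thesis by (rule that[of \<phi>]) (use \<phi> True vw in \<open>auto simp: s'_def r'_def\<close>)
  next
    case False
    then have le: "dw \<le> dv" by simp
    have "dv - dw < pi / 2" using dv dw ca by linarith
    from cis_combination_between[OF le this sr'(2,1) sum(2) pc(2)]
    obtain \<phi> where \<phi>: "dw \<le> \<phi>" "\<phi> \<le> dv" "p - u = complex_of_real (cmod (p - u)) * cis \<phi>"
      "0 < r' \<Longrightarrow> 0 < s' \<Longrightarrow> dw < dv \<Longrightarrow> dw < \<phi> \<and> \<phi> < dv" by metis
    show thesis by (rule that[of \<phi>]) (use \<phi> le vw in \<open>auto simp: s'_def r'_def\<close>)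
  qed
  have rng: "cone_lo n i \<le> \<phi>" "\<phi> < cone_lo n i + cone_angle n" using \<phi>(1,2) dv dw by (auto simp: min_def max_def split: if_splits)
  have i: "i < n" using v by (simp add: in_cone_def)
  have "dir_in_cone n u i p = \<phi>" by (rule dir_in_cone_eqI[OF n2 p(2) rng \<phi>(3)])
  then show "min dv dw \<le> dir_in_cone n u i p" "dir_in_cone n u i p \<le> max dv dw"
    "0 < s \<Longrightarrow> 0 < r \<Longrightarrow> dv \<noteq> dw \<Longrightarrow> min dv dw < dir_in_cone n u i p \<and> dir_in_cone n u i p < max dv dw"
    using \<phi> by simp_all
  show "in_cone n u i p" unfolding in_cone_def using i p(2) rng \<phi>(3) by blast
qed

text \<open>Take the neighbouring split angles, the lower one possibly equal to the direction of
  \<open>w\<close>; they exist because both cone boundaries are split angles.\<close>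

lemma subcone_exists:
  assumes "2 \<le> n" "finite (split_angles n S u i)" "in_cone n u i w"
  obtains a b where "is_subcone n S u i a b" "a \<le> dir_in_cone n u i w" "dir_in_cone n u i w \<le> b"
proof -
  define A where "A = split_angles n S u i"
  define d where "d = dir_in_cone n u i w"
  note dd = dir_in_cone[OF assms(1,3), folded d_def]
  have A: "finite A" "cone_lo n i \<in> A" "cone_lo n i + cone_angle n \<in> A"
    using assms(2) by (auto simp: A_def split_angles_def)
  define a b where "a = Max {x \<in> A. x \<le> d}" and "b = Min {x \<in> A. d < x}"
  have lo: "finite {x \<in> A. x \<le> d}" "{x \<in> A. x \<le> d} \<noteq> {}" using A dd by auto
  have hi: "finite {x \<in> A. d < x}" "{x \<in> A. d < x} \<noteq> {}" using A dd by auto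
  have a: "a \<in> A" "a \<le> d" using Max_in[OF lo] by (auto simp: a_def)
  have b: "b \<in> A" "d < b" using Min_in[OF hi] by (auto simp: b_def)
  have "\<not> (\<exists>x\<in>A. a < x \<and> x < b)"
  proof
    assume "\<exists>x\<in>A. a < x \<and> x < b"
    then obtain x where x: "x \<in> A" "a < x" "x < b" by blast
    show False
    proof (cases "x \<le> d")
      case True
      then have "x \<le> a" unfolding a_def using lo x by (intro Max_ge) auto
      then show False using x by simp
    next
      case False
      then have "b \<le> x" unfolding b_def using hi x by (intro Min_le) auto
      then show False using x by simp
    qed
  qed
  then have "is_subcone n S u i a b" unfolding is_subcone_def A_def[symmetric] using a b by auto
  then show thesis using that a b unfolding d_def by force
qed

subsection \<open>The spanning path\<close>

lemma cos_minus_sin_pos: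
  fixes t :: real
  assumes "0 \<le> t" "t \<le> pi / 8"
  shows "0 < cos t - sin t"
proof -
  have "sin t < sin (pi / 4)" using assms pi_gt_zero by (intro sin_monotone_2pi) linarith+
  also have "\<dots> = cos (pi / 4)" by (simp add: sin_45 cos_45)
  also have "\<dots> < cos t" using assms pi_gt_zero by (intro cos_monotone_0_pi) linarith+
  finally show ?thesis by simp
qed

text \<open>Let \<delta> be the unsigned angle to the bisector. Since
  \<open>2 * \<delta> \<le> pi / 4\<close>, its tangent is at most 1, which forces the tangent of
  \<delta> below 1/2; the distance bound holds because \<open>cos - sin\<close> decreases from
  \<delta> to \<open>t\<close>.\<close>

lemma in_cone_bounds:
  assumes n: "8 \<le> n" and v: "in_cone n u i v"
  defines "z \<equiv> (v - u) * cnj (bisector n i)" and "t \<equiv> cone_angle n / 2"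
  shows "0 < Re z" "2 * \<bar>Im z\<bar> < Re z"
    "dist u v \<le> 1 / (cos t - sin t) * (Re z - \<bar>Im z\<bar>)"
proof -
  define r where "r = cmod (v - u)"
  have r: "0 < r" using v by (auto simp: r_def in_cone_def)
  obtain d where d: "- t \<le> d" "d \<le> t" "z = complex_of_real r * cis d"
    using in_cone_frame[OF v] unfolding r_def t_def z_def by metis
  have t: "0 \<le> t" "t \<le> pi / 8" using n by (auto simp: t_def cone_angle_def field_simps)
  define \<delta> where "\<delta> = \<bar>d\<bar>"
  have \<delta>: "0 \<le> \<delta>" "\<delta> \<le> t" using d by (auto simp: \<delta>_def)
  have s0: "0 \<le> sin \<delta>" using \<delta> t pi_gt_zero by (intro sin_ge_zero) linarith+
  have c0: "0 < cos \<delta>" using \<delta> t pi_gt_zero by (intro cos_gt_zero_pi) linarith+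
  have Re: "Re z = r * cos \<delta>" using d(3) by (simp add: \<delta>_def abs_if)
  have "\<bar>sin d\<bar> = \<bar>sin \<delta>\<bar>" by (simp add: \<delta>_def abs_if)
  then have Im: "\<bar>Im z\<bar> = r * sin \<delta>" using d(3) r s0 by (simp add: abs_mult)
  show "0 < Re z" unfolding Re using r c0 by simp
  have "sin (2 * \<delta>) \<le> sin (pi / 4)" using \<delta> t pi_gt_zero by (intro sin_monotone_2pi_le) linarith+
  also have "\<dots> = cos (pi / 4)" by (simp add: sin_45 cos_45)
  also have "\<dots> \<le> cos (2 * \<delta>)" using \<delta> t pi_gt_zero by (intro cos_monotone_0_pi_le) linarith+
  finally have le: "2 * sin \<delta> * cos \<delta> \<le> (cos \<delta>)\<^sup>2 - (sin \<delta>)\<^sup>2" by (simp add: sin_double cos_double)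
  have "2 * sin \<delta> < cos \<delta>"
  proof (cases "sin \<delta> = 0")
    case False
    then have "2 * sin \<delta> * cos \<delta> < cos \<delta> * cos \<delta>" using le by (smt (verit) power2_eq_square zero_less_power2)
    then show ?thesis using c0 by (simp add: mult_less_cancel_right)
  qed (use c0 in simp)
  then have "r * (2 * sin \<delta>) < r * cos \<delta>" using r by (rule mult_strict_left_mono)
  then show "2 * \<bar>Im z\<bar> < Re z" unfolding Re Im by simp
  have "cos t \<le> cos \<delta>" using \<delta> t pi_gt_zero by (intro cos_monotone_0_pi_le) linarith+
  moreover have "sin \<delta> \<le> sin t" using \<delta> t pi_gt_zero by (intro sin_monotone_2pi_le) linarith+
  ultimately have "r * (cos t - sin t) \<le> r * (cos \<delta> - sin \<delta>)" using r by (intro mult_left_mono) auto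
  then have "r * (cos t - sin t) \<le> Re z - \<bar>Im z\<bar>" unfolding Re Im by (simp add: algebra_simps)
  then have "r \<le> (Re z - \<bar>Im z\<bar>) / (cos t - sin t)"
    using cos_minus_sin_pos[OF t] by (simp add: pos_le_divide_eq)
  then show "dist u v \<le> 1 / (cos t - sin t) * (Re z - \<bar>Im z\<bar>)" by (simp add: r_def dist_norm norm_minus_commute)
qed

lemma proj_bis_Re: "proj_bis n u i p = Re ((p - u) * cnj (bisector n i))"
  by (simp add: proj_bis_def inner_complex_def)

lemma (in constrained_points) finite_split_angles: "finite (split_angles n S u i)"
proof -
  have "{dir_in_cone n u i c | c. {u, c} \<in> S \<and> in_cone n u i c} \<subseteq> dir_in_cone n u i ` P"
    using constraint_endpoints by auto
  from finite_subset[OF this] show ?thesis unfolding split_angles_def using finite_P by simp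
qed

text \<open>With \<open>u\<close> at the origin, \<open>V\<close>, \<open>\<kappa> W\<close>,
  \<open>W\<close> stand for \<open>v\<close>, \<open>o\<close>, \<open>w\<close>. The diameter of a
  triangle is attained at two vertices, so only the three sides need a bound.\<close>

lemma triangle_diameter_less:
  fixes V W :: complex
  assumes "0 < Re V" "Re V \<le> Re W" "2 * \<bar>Im V\<bar> < Re V" "2 * \<bar>Im W\<bar> < Re W"
    and k: "\<kappa> = Re V / Re W"
    and hull: "p \<in> convex hull {V, \<kappa> *\<^sub>R W, W}" "q \<in> convex hull {V, \<kappa> *\<^sub>R W, W}"
  shows "cmod (p - q) < cmod W"
proof -
  have \<kappa>: "0 < \<kappa>" "\<kappa> \<le> 1" "\<kappa> * Re W = Re V" using assms by (auto simp: k)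
  have W: "0 < cmod W" using assms by auto
  have vo: "cmod (V - \<kappa> *\<^sub>R W) < cmod W"
  proof -
    have "cmod (V - \<kappa> *\<^sub>R W) \<le> \<bar>Re (V - \<kappa> *\<^sub>R W)\<bar> + \<bar>Im (V - \<kappa> *\<^sub>R W)\<bar>" by (rule cmod_le)
    also have "\<dots> = \<bar>Im V - \<kappa> * Im W\<bar>" using \<kappa>(3) by simp
    also have "\<dots> \<le> \<bar>Im V\<bar> + \<kappa> * \<bar>Im W\<bar>"
      using \<kappa>(1) abs_triangle_ineq4[of "Im V" "\<kappa> * Im W"] by (simp add: abs_mult)
    also have "\<dots> < Re V"
      using mult_strict_left_mono[OF assms(4) \<kappa>(1)] \<kappa>(3) assms(3) by simp
    also have "\<dots> \<le> cmod W" using assms(2) complex_Re_le_cmod[of W] by linarith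
    finally show ?thesis .
  qed
  have ow: "cmod (\<kappa> *\<^sub>R W - W) < cmod W"
  proof -
    have "\<kappa> *\<^sub>R W - W = (\<kappa> - 1) *\<^sub>R W" by (simp add: algebra_simps)
    then have "cmod (\<kappa> *\<^sub>R W - W) = (1 - \<kappa>) * cmod W" using \<kappa> by simp
    then show ?thesis using mult_pos_pos[OF \<kappa>(1) W] by (simp add: left_diff_distrib)
  qed
  have vw: "cmod (V - W) < cmod W"
  proof (rule power2_less_imp_less)
    have pos: "0 < Re W" "0 < Re V * Re W" using assms by auto
    have "(2 * \<bar>Im V\<bar>) * (2 * \<bar>Im W\<bar>) \<le> Re V * Re W" using assms by (intro mult_mono) auto
    then have vw: "4 * \<bar>Im V * Im W\<bar> \<le> Re V * Re W" by (simp add: abs_mult)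
    have "(2 * \<bar>Im V\<bar>)\<^sup>2 \<le> (Re V)\<^sup>2" using assms by (intro power_mono) auto
    then have v: "4 * (Im V)\<^sup>2 \<le> (Re V)\<^sup>2" by (simp add: power_mult_distrib)
    have v2: "(Re V)\<^sup>2 \<le> Re V * Re W" using assms by (simp add: power2_eq_square)
    \<comment> \<open>With \<open>M = Re V * Re W\<close> the bracket is at most 5/4 M - 2 M + 1/2
      M, which is negative.\<close>
    have "(cmod (V - W))\<^sup>2 = (cmod W)\<^sup>2 + ((Re V)\<^sup>2 + (Im V)\<^sup>2 - 2 * (Re V * Re W) - 2 * (Im V * Im W))"
      by (simp add: cmod_power2 power2_diff)
    also have "\<dots> < (cmod W)\<^sup>2" using vw v v2 pos by linarith
    finally show "(cmod (V - W))\<^sup>2 < (cmod W)\<^sup>2" .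
  qed simp
  obtain a b where "a \<in> {V, \<kappa> *\<^sub>R W, W}" "b \<in> {V, \<kappa> *\<^sub>R W, W}" "cmod (p - q) \<le> cmod (a - b)"
    using simplex_extremal_le_exists[OF _ hull] by blast
  moreover from this have "cmod (a - b) < cmod W"
    using vo ow vw W norm_minus_commute[of V "\<kappa> *\<^sub>R W"] norm_minus_commute[of W "\<kappa> *\<^sub>R W"]
      norm_minus_commute[of V W] by auto
  ultimately show ?thesis by linarith
qed

lemma in_convex_hull_above:
  fixes V W :: complex
  assumes "0 \<le> s" "0 \<le> r" "s + r \<le> 1" "\<kappa> * (1 - s) \<le> r" "\<kappa> \<le> 1"
  shows "s *\<^sub>R V + r *\<^sub>R W \<in> convex hull {V, \<kappa> *\<^sub>R W, W}"
proof (cases "\<kappa> = 1")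
  case True
  then have "r = 1 - s" using assms by simp
  then show ?thesis unfolding convex_hull_3 using assms(1,2)
    by (intro CollectI exI[of _ s] exI[of _ 0] exI[of _ "1 - s"]) auto
next
  case False
  then have \<kappa>: "0 < 1 - \<kappa>" using assms by simp
  \<comment> \<open>The solution of \<open>s + a + b = 1\<close> and
    \<open>a * \<kappa> + b = r\<close>, the weights of \<open>\<kappa> W\<close> and
    \<open>W\<close>; for \<kappa> = 1 these two vertices coincide.\<close>
  define a b where "a = (1 - s - r) / (1 - \<kappa>)" and "b = (r - \<kappa> * (1 - s)) / (1 - \<kappa>)"
  have ab: "0 \<le> a" "0 \<le> b" using assms \<kappa> by (simp_all add: a_def b_def)
  have "a + b = (1 - s - r + (r - \<kappa> * (1 - s))) / (1 - \<kappa>)"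
    unfolding a_def b_def by (rule add_divide_distrib[symmetric])
  also have "1 - s - r + (r - \<kappa> * (1 - s)) = (1 - s) * (1 - \<kappa>)" by (simp add: algebra_simps)
  finally have "s + a + b = 1" using \<kappa> by simp
  have "a * \<kappa> + b = ((1 - s - r) * \<kappa> + (r - \<kappa> * (1 - s))) / (1 - \<kappa>)"
    unfolding a_def b_def times_divide_eq_left by (rule add_divide_distrib[symmetric])
  also have "(1 - s - r) * \<kappa> + (r - \<kappa> * (1 - s)) = r * (1 - \<kappa>)" by (simp add: algebra_simps)
  finally have "a * \<kappa> + b = r" using \<kappa> by simp
  note sum = \<open>s + a + b = 1\<close> \<open>a * \<kappa> + b = r\<close>
  have "s *\<^sub>R V + r *\<^sub>R W = s *\<^sub>R V + a *\<^sub>R (\<kappa> *\<^sub>R W) + b *\<^sub>R W"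
    unfolding sum(2)[symmetric] by (simp add: algebra_simps)
  then show ?thesis unfolding convex_hull_3 using assms(1) ab sum(1) by blast
qed

section \<open>Induction over visible pairs\<close>

context constrained_points
begin

lemma theta_path:
  fixes k n :: nat
  assumes k: "1 \<le> k" and n: "n = 4 * k + 4"
  defines "C \<equiv> 1 / (cos (cone_angle n / 2) - sin (cone_angle n / 2))"
  assumes "u \<in> P" "w \<in> P" "sees S u w" "in_cone n u i w"
  shows "reach n P S u w (C * l1 (bisector n i) (w - u))"
  using assms(4-)
\<comment> \<open>The number of pairs at smaller distance is the rank of the distance of
  \<open>u\<close> and \<open>w\<close>.\<close>
proof (induction "card {(p, q) \<in> P \<times> P. dist p q < dist u w}" arbitrary: u w i rule: less_induct)
  case less
  note uP = less.prems(1) and wP = less.prems(2) and uw = less.prems(3) and wc = less.prems(4)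
  have n8: "8 \<le> n" "5 \<le> n" "2 \<le> n" "0 < n" using k n by auto
  have C: "0 < C"
    unfolding C_def using n8 by (intro divide_pos_pos cos_minus_sin_pos) (auto simp: cone_angle_def field_simps)
  have IH: "reach n P S p q (C * l1 (bisector n j) (q - p))"
    if "p \<in> P" "q \<in> P" "sees S p q" "in_cone n p j q" "dist p q < dist u w" for p q j
  proof (rule less.hyps[OF _ that(1-4)])
    show "card {(p', q') \<in> P \<times> P. dist p' q' < dist p q} < card {(p', q') \<in> P \<times> P. dist p' q' < dist u w}"
    proof (rule psubset_card_mono)
      show "finite {(p', q') \<in> P \<times> P. dist p' q' < dist u w}"
        by (rule finite_subset[of _ "P \<times> P"]) (use finite_P in auto)
      have "(p, q) \<in> {(p', q') \<in> P \<times> P. dist p' q' < dist u w}" using that by auto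
      moreover have "(p, q) \<notin> {(p', q') \<in> P \<times> P. dist p' q' < dist p q}" by auto
      moreover have "{(p', q') \<in> P \<times> P. dist p' q' < dist p q} \<subseteq> {(p', q') \<in> P \<times> P. dist p' q' < dist u w}"
        using that(5) by auto
      ultimately show "{(p', q') \<in> P \<times> P. dist p' q' < dist p q} \<subset> {(p', q') \<in> P \<times> P. dist p' q' < dist u w}"
        by blast
    qed
  qed
  define b where "b = bisector n i"
  define Z where "Z p = (p - u) * cnj b" for p
  have proj: "proj_bis n u i p = Re (Z p)" for p by (simp add: proj_bis_Re Z_def b_def)
  note bounds = in_cone_bounds[OF n8(1), of u i, folded b_def, folded Z_def, folded C_def]
  obtain a a' where sub: "is_subcone n S u i a a'" "a \<le> dir_in_cone n u i w" "dir_in_cone n u i w \<le> a'"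
    using subcone_exists[OF n8(3) finite_split_angles wc] by metis
  define Q where "Q = {x \<in> P. x \<in> subcone_pts n u i a a' \<and> sees S u x}"
  have "finite Q" "w \<in> Q" using finite_P wP uw wc sub by (auto simp: Q_def subcone_pts_def)
  then obtain v where v: "v \<in> Q" "\<And>p. p \<in> Q \<Longrightarrow> Re (Z v) \<le> Re (Z p)"
    using arg_min_if_finite[of Q "\<lambda>p. Re (Z p)"] by (metis empty_iff leI)
  have vP: "v \<in> P" "sees S u v" "in_cone n u i v" "a \<le> dir_in_cone n u i v" "dir_in_cone n u i v \<le> a'"
    using v(1) by (auto simp: Q_def subcone_pts_def)
  have in_lt: "i < n" using wc by (simp add: in_cone_def)
  have "\<forall>x\<in>P. x \<in> subcone_pts n u i a a' \<longrightarrow> sees S u x \<longrightarrow> proj_bis n u i v \<le> proj_bis n u i x"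
    unfolding proj using v(2) by (simp add: Q_def)
  moreover have "v \<in> subcone_pts n u i a a'" using v(1) by (simp add: Q_def)
  ultimately have "theta_selects n P S u v"
    unfolding theta_selects_def using uP vP(1,2) in_lt sub(1) by blast
  then have uv: "reach n P S u v (dist u v)" by (intro reach_edge) (simp add: theta_edge_def)
  have bv: "0 < Re (Z v)" "2 * \<bar>Im (Z v)\<bar> < Re (Z v)" "dist u v \<le> C * (Re (Z v) - \<bar>Im (Z v)\<bar>)"
    and bw: "0 < Re (Z w)" "2 * \<bar>Im (Z w)\<bar> < Re (Z w)"
    using bounds[OF vP(3)] bounds[OF wc] by auto
  have l1w: "l1 b (w - u) = Re (Z w) + \<bar>Im (Z w)\<bar>" using bw(1) by (simp add: l1_def Z_def)
  show ?case
  proof (cases "v = w")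
    case True
    have "C * (Re (Z w) - \<bar>Im (Z w)\<bar>) \<le> C * l1 b (w - u)" unfolding l1w using C by (intro mult_left_mono) auto
    then show ?thesis using reach_mono[OF uv] bv(3) True by (simp add: b_def)
  next
    case False
    have neq: "u \<noteq> v" "u \<noteq> w" using vP(3) wc by (auto simp: in_cone_def)
    have D: "crs (v - u) (w - u) \<noteq> 0" using crs_eq_0D[OF uP vP(1) wP] neq False by auto
    have dvw: "dir_in_cone n u i v \<noteq> dir_in_cone n u i w"
    proof
      assume eq: "dir_in_cone n u i v = dir_in_cone n u i w"
      have "crs (complex_of_real x * c) (complex_of_real y * c) = 0" for x y c by (simp add: crs_def)
      then show False
        using D dir_in_cone(3)[OF n8(3) vP(3)] dir_in_cone(3)[OF n8(3) wc] unfolding eq by metis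
    qed
    define \<kappa> where "\<kappa> = Re (Z v) / Re (Z w)"
    have vw: "Re (Z v) \<le> Re (Z w)" using v(2) \<open>w \<in> Q\<close> by blast
    have \<kappa>: "0 < \<kappa>" "\<kappa> \<le> 1" "\<kappa> * Re (Z w) = Re (Z v)" using vw bv(1) bw(1) by (auto simp: \<kappa>_def)
    have dec: "p - u = bary u v w p *\<^sub>R (v - u) + bary u w v p *\<^sub>R (w - u)" for p
      using bary_decomp[OF D, of p] by (simp add: algebra_simps)
    have Zdec: "Z p = bary u v w p *\<^sub>R Z v + bary u w v p *\<^sub>R Z w" for p
    proof -
      have "Z p = (bary u v w p *\<^sub>R (v - u) + bary u w v p *\<^sub>R (w - u)) * cnj b"
        unfolding Z_def dec[of p, symmetric] ..
      then show ?thesis by (simp add: Z_def distrib_right)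
    qed
    have pts: "in_cone n u i p" "p \<in> subcone_pts n u i a a'" if "p \<noteq> u" "in_tri u v w p" for p
    proof -
      have c: "in_cone n u i p"
        "min (dir_in_cone n u i v) (dir_in_cone n u i w) \<le> dir_in_cone n u i p"
        "dir_in_cone n u i p \<le> max (dir_in_cone n u i v) (dir_in_cone n u i w)"
        using in_cone_combination[OF n8(2) vP(3) wc _ _ dec that(1)] that(2) by (auto simp: in_tri_def)
      then show "in_cone n u i p" "p \<in> subcone_pts n u i a a'"
        using sub(2,3) vP(4,5) by (auto simp: subcone_pts_def)
    qed
    have nocon: "\<not> (0 < bary u v w c \<and> 0 < bary u w v c)" if c: "{u, c} \<in> S" for c
    proof
      assume pos: "0 < bary u v w c \<and> 0 < bary u w v c"
      have cu: "c \<noteq> u" using pos by auto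
      note comb = in_cone_combination[OF n8(2) vP(3) wc _ _ dec cu]
      have cc: "in_cone n u i c" using comb(1) pos by simp
      have "a < dir_in_cone n u i c" "dir_in_cone n u i c < a'"
        using comb(4) pos dvw sub(2,3) vP(4,5) by (auto simp: min_def max_def split: if_splits)
      moreover have "dir_in_cone n u i c \<in> split_angles n S u i"
        unfolding split_angles_def using c cc by blast
      ultimately show False using sub(1) unfolding is_subcone_def by blast
    qed
    \<comment> \<open>A point \<open>q\<close> of the triangle with least projection sees
      \<open>u\<close> and lies in the subcone, so it competes with \<open>v\<close> for the edge;
      hence nothing in the triangle projects below \<open>v\<close>.\<close>
    have low: "Re (Z v) \<le> Re (Z p)" if "p \<in> P" "p \<noteq> u" "in_tri u v w p" for p
    proof -
      define T where "T = {x \<in> P. x \<noteq> u \<and> in_tri u v w x}"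
      have "finite T" "p \<in> T" using finite_P that by (auto simp: T_def)
      then obtain q where q: "q \<in> T" "\<And>x. x \<in> T \<Longrightarrow> Re (Z q) \<le> Re (Z x)"
        using arg_min_if_finite[of T "\<lambda>p. Re (Z p)"] by (metis empty_iff leI)
      have qT: "q \<in> P" "q \<noteq> u" "in_tri u v w q" using q(1) by (auto simp: T_def)
      have q0: "0 < Re (Z q)" using bounds(1)[OF pts(1)[OF qT(2,3)]] .
      \<comment> \<open>The projection is linear in the coordinates; dividing by that of
        \<open>q\<close> normalises the height of \<open>q\<close> to 1.\<close>
      have lin: "Re (Z v) / Re (Z q) * bary u v w x + Re (Z w) / Re (Z q) * bary u w v x = Re (Z x) / Re (Z q)" for x
        by (subst Zdec[of x]) (simp add: add_divide_distrib mult.commute)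
      have "sees S u q"
      proof (rule sees_lowest[where \<alpha> = "Re (Z v) / Re (Z q)" and \<beta> = "Re (Z w) / Re (Z q)",
            OF uP vP(1) wP qT(1) D vP(2) uw qT(2,3)])
        show "Re (Z v) / Re (Z q) * bary u v w q + Re (Z w) / Re (Z q) * bary u w v q \<le> 1"
          unfolding lin using q0 by simp
        show "1 \<le> Re (Z v) / Re (Z q) * bary u v w x + Re (Z w) / Re (Z q) * bary u w v x"
          if "x \<in> P" "x \<noteq> u" "in_tri u v w x" for x
          unfolding lin using q(2)[of x] q0 that by (simp add: T_def)
      qed
      then have "q \<in> Q" using qT pts(2)[OF qT(2,3)] by (simp add: Q_def)
      then show ?thesis using v(2) q(2)[OF \<open>p \<in> T\<close>] by fastforce
    qed
    have above: "\<kappa> * (1 - bary u v w p) \<le> bary u w v p" if p: "p \<in> P" "p \<noteq> u" "in_tri u v w p" for p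
    proof -
      have "Re (Z v) \<le> bary u v w p * Re (Z v) + bary u w v p * Re (Z w)"
        using low[OF p] by (subst (asm) (2) Zdec) simp
      then have "Re (Z v) * (1 - bary u v w p) \<le> bary u w v p * Re (Z w)" by (simp add: algebra_simps)
      then show ?thesis using bw(1) by (simp add: \<kappa>_def pos_divide_le_eq)
    qed
    have cb: "cmod (cnj b) = 1" by (simp add: b_def bisector_def)
    have short: "dist p q < dist u w"
      if "p \<in> P" "p \<noteq> u" "in_tri u v w p" "q \<in> P" "q \<noteq> u" "in_tri u v w q" for p q
    proof -
      have "Z p \<in> convex hull {Z v, \<kappa> *\<^sub>R Z w, Z w}" "Z q \<in> convex hull {Z v, \<kappa> *\<^sub>R Z w, Z w}"
        unfolding Zdec[of p] Zdec[of q] using that above \<kappa>(2)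
        by (auto intro!: in_convex_hull_above simp: in_tri_def)
      from triangle_diameter_less[OF bv(1) vw bv(2) bw(2) \<kappa>_def this]
      have "cmod (Z p - Z q) < cmod (Z w)" .
      moreover have "Z p - Z q = (p - q) * cnj b" by (simp add: Z_def algebra_simps)
      ultimately show ?thesis using cb by (simp add: Z_def norm_mult dist_norm norm_minus_commute)
    qed
    \<comment> \<open>The induction hypothesis measures the edge in its own frame; passing to the
      frame of \<open>u\<close> can only increase the norm.\<close>
    have step: "reach n P S p q (C * l1 b (q - p))"
      if pq: "p \<in> P" "q \<in> P" "p \<noteq> u" "q \<noteq> u" "p \<noteq> q" "in_tri u v w p" "in_tri u v w q" "sees S p q" for p q
    proof -
      obtain j where j: "in_cone n p j q" using in_cone_exists[OF n8(4) pq(5)[symmetric]] by blast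
      have "reach n P S p q (C * l1 (bisector n j) (q - p))"
        by (rule IH[OF pq(1,2,8) j short[OF pq(1,3,6,2,4,7)]])
      moreover have "C * l1 (bisector n j) (q - p) \<le> C * l1 b (q - p)"
        unfolding b_def using C l1_own_bisector_le[OF j n] by (intro mult_left_mono) auto
      ultimately show ?thesis by (rule reach_mono)
    qed
    have chain: "reach n P S v w (C * (l1 b (\<kappa> *\<^sub>R (w - u) - (v - u)) + (1 - \<kappa>) * l1 b (w - u)))"
    proof (rule convex_chain[where N = "l1 b" and R = "reach n P S" and C = C])
      show "0 \<le> C" using C by simp
    qed (fact l1_triangle l1_scale reach_trans reach_mono uP wP uw vP(1) D vP(2) nocon \<kappa>(1) \<kappa>(2) above step)+
    \<comment> \<open>\<open>v\<close> and \<open>o\<close> have the same projection, so only the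
      perpendicular component contributes.\<close>
    have "(\<kappa> *\<^sub>R (w - u) - (v - u)) * cnj b = \<kappa> *\<^sub>R Z w - Z v" by (simp add: Z_def algebra_simps)
    then have "l1 b (\<kappa> *\<^sub>R (w - u) - (v - u)) = \<bar>\<kappa> * Im (Z w) - Im (Z v)\<bar>"
      unfolding l1_def using \<kappa>(3) by simp
    also have "\<dots> \<le> \<kappa> * \<bar>Im (Z w)\<bar> + \<bar>Im (Z v)\<bar>"
      using \<kappa>(1) abs_triangle_ineq4[of "\<kappa> * Im (Z w)" "Im (Z v)"] by (simp add: abs_mult)
    finally have "l1 b (\<kappa> *\<^sub>R (w - u) - (v - u)) \<le> \<kappa> * \<bar>Im (Z w)\<bar> + \<bar>Im (Z v)\<bar>" .
    \<comment> \<open>The real parts sum to that of \<open>Z w\<close>; the gain of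
      \<open>\<bar>Im (Z v)\<bar>\<close> from the first edge pays for the detour to
      \<open>o\<close>.\<close>
    then have "(Re (Z v) - \<bar>Im (Z v)\<bar>) + (l1 b (\<kappa> *\<^sub>R (w - u) - (v - u)) + (1 - \<kappa>) * l1 b (w - u)) \<le> l1 b (w - u)"
      unfolding l1w using \<kappa>(3) by (simp add: algebra_simps)
    then have "C * ((Re (Z v) - \<bar>Im (Z v)\<bar>) + (l1 b (\<kappa> *\<^sub>R (w - u) - (v - u)) + (1 - \<kappa>) * l1 b (w - u)))
        \<le> C * l1 b (w - u)" using C by (intro mult_left_mono) auto
    then have "dist u v + C * (l1 b (\<kappa> *\<^sub>R (w - u) - (v - u)) + (1 - \<kappa>) * l1 b (w - u)) \<le> C * l1 b (w - u)"
      using bv(3) by (simp add: distrib_left)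
    then show ?thesis using reach_mono[OF reach_trans[OF uv chain]] by (simp add: b_def)
  qed
qed

end

section \<open>The stated bound as a multiple of an L1 norm\<close>

lemma canonical_bound_eq:
  assumes n: "8 \<le> n" and w: "in_cone n u i w"
  defines "t \<equiv> cone_angle n / 2" and "\<alpha> \<equiv> vec_angle (w - u) (canon_mid n u i w - u)"
  shows "(cos \<alpha> / cos t + (cos \<alpha> * tan t + sin \<alpha>) / (cos t - sin t)) * dist u w
    = 1 / (cos t - sin t) * l1 (bisector n i) (w - u)"
proof -
  define b where "b = bisector n i"
  define z where "z = (w - u) * cnj b"
  define r where "r = cmod (w - u)"
  have X: "0 < Re z" using in_cone_bounds(1)[OF n w] by (simp add: z_def b_def)
  have b: "cmod b = 1" by (simp add: b_def bisector_def)
  have r: "0 < r" using w by (auto simp: r_def in_cone_def)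
  have "cmod z = r" by (simp add: z_def norm_mult b r_def)
  then have r2: "r\<^sup>2 = (Re z)\<^sup>2 + (Im z)\<^sup>2" by (metis cmod_power2)
  have mid: "canon_mid n u i w - u = Re z *\<^sub>R b"
    by (simp add: canon_mid_def proj_bis_Re z_def b_def scaleR_conv_of_real)
  have "inner (w - u) b = Re z" by (simp add: z_def inner_complex_def)
  then have "inner (w - u) (canon_mid n u i w - u) / (norm (w - u) * norm (canon_mid n u i w - u)) = Re z / r"
    unfolding mid using X b by (simp add: r_def)
  then have al: "\<alpha> = arccos (Re z / r)" by (simp add: \<alpha>_def vec_angle_def)
  have le: "Re z \<le> r" using complex_Re_le_cmod[of z] \<open>cmod z = r\<close> by simp
  have bnd: "- 1 \<le> Re z / r" "Re z / r \<le> 1"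
    using le X r by (simp_all add: pos_le_divide_eq pos_divide_le_eq)
  have ca: "cos \<alpha> * r = Re z" unfolding al using bnd r by simp
  \<comment> \<open>The arccosine lies between 0 and \<pi>, so the sine is nonnegative and the sign
    of \<open>Im z\<close> disappears.\<close>
  have "sin \<alpha> * r = \<bar>Im z\<bar>"
  proof -
    have s: "0 \<le> sin \<alpha>" unfolding al using bnd by (intro sin_ge_zero arccos_lbound arccos_ubound)
    have "(sin \<alpha> * r)\<^sup>2 = r\<^sup>2 - (cos \<alpha> * r)\<^sup>2"
      by (simp add: power_mult_distrib sin_squared_eq algebra_simps)
    also have "\<dots> = \<bar>Im z\<bar>\<^sup>2" unfolding ca r2 by simp
    finally show ?thesis
      by (rule power2_eq_imp_eq) (use mult_nonneg_nonneg[OF s less_imp_le[OF r]] in simp_all)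
  qed
  note sa = this
  have t: "0 \<le> t" "t \<le> pi / 8" using n by (auto simp: t_def cone_angle_def field_simps)
  have cs: "0 < cos t - sin t" by (rule cos_minus_sin_pos[OF t])
  have ct: "0 < cos t" using t pi_gt_zero by (intro cos_gt_zero_pi) linarith+
  \<comment> \<open>Rests on
    \<open>1 / cos t + tan t / (cos t - sin t) = 1 / (cos t - sin t)\<close>.\<close>
  have key: "x / cos t + (x * tan t + y) / (cos t - sin t) = 1 / (cos t - sin t) * (x + y)" for x y
    using cs ct by (simp add: tan_def field_simps)
  have "(cos \<alpha> / cos t + (cos \<alpha> * tan t + sin \<alpha>) / (cos t - sin t)) * r
    = 1 / (cos t - sin t) * (cos \<alpha> * r + sin \<alpha> * r)" unfolding key by (simp add: distrib_right)
  also have "\<dots> = 1 / (cos t - sin t) * l1 b (w - u)"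
    unfolding ca sa l1_def z_def[symmetric] using X by simp
  finally show ?thesis by (simp add: r_def b_def dist_norm norm_minus_commute)
qed

theorem theorem3:
  fixes k :: nat and P :: "complex set" and S :: "complex set set"
    and u w :: complex and i :: nat
  defines "n \<equiv> 4 * k + 4"
  defines "\<theta> \<equiv> 2 * pi / real (4 * k + 4)"
  assumes "k \<ge> 1"
    and "finite P"
    and "general_position n P"
    and "valid_constraints P S"
    and "u \<in> P" and "w \<in> P" and "u \<noteq> w"
    and "sees S u w"
    and "in_cone n u i w"
  defines "\<alpha> \<equiv> vec_angle (w - u) (canon_mid n u i w - u)"
  shows "\<exists>xs. is_path n P S xs u w \<and>
           path_length xs \<le> (cos \<alpha> / cos (\<theta> / 2)
              + (cos \<alpha> * tan (\<theta> / 2) + sin \<alpha>) / (cos (\<theta> / 2) - sin (\<theta> / 2))) * dist u w"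
proof -
  interpret constrained_points P S
  proof
    show "finite P" "valid_constraints P S" by fact+
    show "\<not> collinear {a, b, c}" if "a \<in> P" "b \<in> P" "c \<in> P" "a \<noteq> b" "b \<noteq> c" "a \<noteq> c" for a b c
      using conjunct2[OF \<open>general_position n P\<close>[unfolded general_position_def]] that by blast
  qed
  have \<theta>: "\<theta> = cone_angle n" by (simp add: \<theta>_def n_def cone_angle_def)
  have "reach n P S u w (1 / (cos (\<theta> / 2) - sin (\<theta> / 2)) * l1 (bisector n i) (w - u))"
    unfolding \<theta> by (rule theta_path[OF \<open>k \<ge> 1\<close>]) (use assms in \<open>simp_all add: n_def\<close>)
  moreover have "8 \<le> n" using \<open>k \<ge> 1\<close> by (simp add: n_def)
  note canonical_bound_eq[OF this \<open>in_cone n u i w\<close>, folded \<theta>, folded \<alpha>_def]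
  ultimately show ?thesis unfolding reach_def by simp
qed

end
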